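(* Let $(M,\omega)$ be a compact quantizable Kähler manifold with very ample quantum line bundle, and let $\star$, with coefficients $C_k$, be its Berezin-Toeplitz star product. Then for all $g\in C^\infty(M)$, with $1$ the constant function, $$1\star g=g\star 1=g.$$ Equivalently, $C_k(1,g)=C_k(g,1)=0$ for all $k\ge1$.
   Context: $\mathbb{N}=\{1,2,3,\dots\}$. $(M,\omega)$ is a compact complex Kähler manifold of complex dimension $n$; $C^\infty(M)$ is the algebra of complex-valued smooth functions. Hamiltonian vector fields and Poisson bracket: $\omega(X_f,\cdot)=df(\cdot)$, $\{f,g\}:=\omega(X_f,X_g)$. $(M,\omega)$ is quantizable if there is a quantum line bundle $(L,h,\nabla)$: a holomorphic line bundle $L$ with Hermitian metric $h$ and connection $\nabla$ compatible with $h$ and with the complex structure, with curvature $\nabla_X\nabla_Y-\nabla_Y\nabla_X-\nabla_{[X,Y]}=-\mathrm{i}\,\omega(X,Y)$. Standing assumption: such a bundle is fixed and $L$ is very ample. For $m\in\mathbb{N}$, $L^m=L^{\otimes m}$ carries the induced metric $h^{(m)}$. The Liouville volume form is $\Omega=\frac1{n!}\omega^n$, and sections of $L^m$ have scalar product $\langle\varphi,\psi\rangle=\int_M h^{(m)}(\varphi,\psi)\,\Omega$ (conjugate-linear in the first argument). $\Pi^{(m)}:\mathrm{L}^2(M,L^m)\to\Gamma_{hol}(M,L^m)$ is the orthogonal projection onto the finite-dimensional space of holomorphic sections. The Berezin-Toeplitz operator of $f\in C^\infty(M)$ is $T_f^{(m)}:\Gamma_{hol}(M,L^m)\to\Gamma_{hol}(M,L^m)$,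 $s\mapsto\Pi^{(m)}(fs)$; $\|\cdot\|$ is the operator norm on $\Gamma_{hol}(M,L^m)$. A (formal) star product on $C^\infty(M)$ is an associative $\mathbb{C}[[\nu]]$-bilinear product $\star$ on $C^\infty(M)[[\nu]]$ of the form $f\star g=\sum_{j\ge0}C_j(f,g)\nu^j$ for $f,g\in C^\infty(M)$, with $\mathbb{C}$-bilinear maps $C_j:C^\infty(M)\times C^\infty(M)\to C^\infty(M)$ (extended to formal power series by $(\sum_k\nu^k f_k)\star(\sum_l\nu^l g_l)=\sum_{j,k,l}\nu^{j+k+l}C_j(f_k,g_l)$), satisfying $C_0(f,g)=f\cdot g$ and $C_1(f,g)-C_1(g,f)=-\mathrm{i}\{f,g\}$. The Berezin-Toeplitz star product is the unique star product $f\star g=\sum_{j\ge0}\nu^jC_j(f,g)$ such that for all $f,g\in C^\infty(M)$ and $N\in\mathbb{N}$ there is a constant $K_N(f,g)$ with $\|T_f^{(m)}T_g^{(m)}-\sum_{0\le j<N}m^{-j}T^{(m)}_{C_j(f,g)}\|\le K_N(f,g)\,m^{-N}$ for all $m\in\mathbb{N}$ (its existence and uniqueness are known). *)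

theory Defs
  imports "HOL-Analysis.Analysis"
begin

section \<open>Smooth and holomorphic functions on open sets\<close>

primrec Ck_on :: "nat \<Rightarrow> 'a::real_normed_vector set \<Rightarrow> ('a \<Rightarrow> 'b::real_normed_vector) \<Rightarrow> bool" where
  "Ck_on 0 S f \<longleftrightarrow> continuous_on S f"
| "Ck_on (Suc k) S f \<longleftrightarrow>
     f differentiable_on S \<and> (\<forall>v. Ck_on k S (\<lambda>x. frechet_derivative f (at x) v))"

text \<open>Used for open subsets \<open>S\<close> of finite-dimensional spaces only.\<close>
definition smooth_on :: "'a::real_normed_vector set \<Rightarrow> ('a \<Rightarrow> 'b::real_normed_vector) \<Rightarrow> bool" where
  "smooth_on S f \<longleftrightarrow> (\<forall>k. Ck_on k S f)"

text \<open>Several complex variables: the real derivative exists and is complex linear.\<close>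
definition holo_on :: "(complex^'n) set \<Rightarrow> (complex^'n \<Rightarrow> complex) \<Rightarrow> bool" where
  "holo_on S f \<longleftrightarrow>
     (\<forall>x\<in>S. \<exists>D. (f has_derivative D) (at x) \<and> (\<forall>v. D (\<i> *s v) = \<i> * D v))"


section \<open>Complex manifolds\<close>

text \<open>
  The manifold is the whole type \<open>'a\<close>, and its complex dimension is \<open>CARD('n)\<close>. The atlas is indexed
  by the type \<open>'c\<close>. The chart \<open>chart M c\<close> is meaningful on \<open>cdom M c\<close> only.
\<close>
record ('a, 'n::finite, 'c) atlas =
  cdom :: "'c \<Rightarrow> 'a set"
  chart :: "'c \<Rightarrow> 'a \<Rightarrow> complex^'n"

definition inv_chart :: "('a, 'n::finite, 'c, 'z) atlas_scheme \<Rightarrow> 'c \<Rightarrow> complex^'n \<Rightarrow> 'a" where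
  "inv_chart M c = inv_into (cdom M c) (chart M c)"

definition complex_manifold :: "('a::t2_space, 'n::finite, 'c, 'z) atlas_scheme \<Rightarrow> bool" where
  "complex_manifold M \<longleftrightarrow>
     (\<Union>c. cdom M c) = UNIV \<and>
     (\<forall>c. open (cdom M c) \<and> open (chart M c ` cdom M c) \<and>
          homeomorphism (cdom M c) (chart M c ` cdom M c) (chart M c) (inv_chart M c)) \<and>
     (\<forall>c d k. holo_on (chart M c ` (cdom M c \<inter> cdom M d)) (\<lambda>x. chart M d (inv_chart M c x) $ k))"

definition chart_at :: "('a, 'n::finite, 'c, 'z) atlas_scheme \<Rightarrow> 'a \<Rightarrow> 'c" where
  "chart_at M p = (SOME c. p \<in> cdom M c)"

definition smooth_fun_on ::
    "('a, 'n::finite, 'c, 'z) atlas_scheme \<Rightarrow> 'a set \<Rightarrow> ('a \<Rightarrow> 'b::real_normed_vector) \<Rightarrow> bool" where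
  "smooth_fun_on M V f \<longleftrightarrow> (\<forall>c. smooth_on (chart M c ` (cdom M c \<inter> V)) (\<lambda>x. f (inv_chart M c x)))"

definition holo_fun_on ::
    "('a, 'n::finite, 'c, 'z) atlas_scheme \<Rightarrow> 'a set \<Rightarrow> ('a \<Rightarrow> complex) \<Rightarrow> bool" where
  "holo_fun_on M V f \<longleftrightarrow> (\<forall>c. holo_on (chart M c ` (cdom M c \<inter> V)) (\<lambda>x. f (inv_chart M c x)))"

abbreviation smooth_fun :: "('a, 'n::finite, 'c, 'z) atlas_scheme \<Rightarrow> ('a \<Rightarrow> 'b::real_normed_vector) \<Rightarrow> bool" where
  "smooth_fun M \<equiv> smooth_fun_on M UNIV"

text \<open>Differential at \<open>p\<close> of \<open>f\<close>, as a real linear map on the components of tangent vectors in chart \<open>c\<close>.\<close>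
definition diff_in ::
    "('a, 'n::finite, 'c, 'z) atlas_scheme \<Rightarrow> 'c \<Rightarrow> ('a \<Rightarrow> 'b::real_normed_vector) \<Rightarrow> 'a \<Rightarrow> complex^'n \<Rightarrow> 'b" where
  "diff_in M c f p v = frechet_derivative (\<lambda>x. f (inv_chart M c x)) (at (chart M c p)) v"

text \<open>
  Real vector fields: \<open>X c p\<close> is the component vector of \<open>X\<close> at \<open>p\<close> in the chart \<open>c\<close>. In the chart
  \<open>c\<close> the complex structure is multiplication by \<open>\<i>\<close> on components. Vanishing off the chart
  domain makes the representation unique.
\<close>
definition vector_field :: "('a, 'n::finite, 'c, 'z) atlas_scheme \<Rightarrow> ('c \<Rightarrow> 'a \<Rightarrow> complex^'n) \<Rightarrow> bool" where
  "vector_field M X \<longleftrightarrow>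
     (\<forall>c. smooth_fun_on M (cdom M c) (X c)) \<and>
     (\<forall>c d. \<forall>p \<in> cdom M c \<inter> cdom M d. X d p = diff_in M c (chart M d) p (X c p)) \<and>
     (\<forall>c. \<forall>p. p \<notin> cdom M c \<longrightarrow> X c p = 0)"

definition vf_apply ::
    "('a, 'n::finite, 'c, 'z) atlas_scheme \<Rightarrow> ('c \<Rightarrow> 'a \<Rightarrow> complex^'n) \<Rightarrow> ('a \<Rightarrow> 'b::real_normed_vector) \<Rightarrow> 'a \<Rightarrow> 'b" where
  "vf_apply M X f p = diff_in M (chart_at M p) f p (X (chart_at M p) p)"

definition lie_bracket ::
    "('a, 'n::finite, 'c, 'z) atlas_scheme \<Rightarrow> ('c \<Rightarrow> 'a \<Rightarrow> complex^'n) \<Rightarrow> ('c \<Rightarrow> 'a \<Rightarrow> complex^'n)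
      \<Rightarrow> 'c \<Rightarrow> 'a \<Rightarrow> complex^'n" where
  "lie_bracket M X Y c p =
     (if p \<in> cdom M c then diff_in M c (Y c) p (X c p) - diff_in M c (X c) p (Y c p) else 0)"

definition vf_J :: "('c \<Rightarrow> 'a \<Rightarrow> complex^'n) \<Rightarrow> 'c \<Rightarrow> 'a \<Rightarrow> complex^'n" where
  "vf_J X c p = \<i> *s X c p"


section \<open>Kaehler form, Poisson bracket and Liouville volume\<close>

text \<open>
  \<open>omega M c p\<close> is the form at \<open>p\<close> on component vectors in the chart \<open>c\<close>; \<open>vol M\<close> is the Borel measure
  of the Liouville volume form, see \<open>liouville_volume\<close>.
\<close>
record ('a, 'n::finite, 'c) kaehler_data = "('a, 'n, 'c) atlas" +
  omega :: "'c \<Rightarrow> 'a \<Rightarrow> complex^'n \<Rightarrow> complex^'n \<Rightarrow> real"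
  vol :: "'a measure"

text \<open>The third clause from the end is \<open>d\<omega> = 0\<close>, evaluated on constant vector fields of a chart.\<close>
definition kaehler_form :: "('a, 'n::finite, 'c, 'z) kaehler_data_scheme \<Rightarrow> bool" where
  "kaehler_form M \<longleftrightarrow>
     (\<forall>c. \<forall>p \<in> cdom M c. bilinear (omega M c p) \<and> (\<forall>v. omega M c p v v = 0)) \<and>
     (\<forall>c d. \<forall>p \<in> cdom M c \<inter> cdom M d. \<forall>v w.
        omega M c p v w = omega M d p (diff_in M c (chart M d) p v) (diff_in M c (chart M d) p w)) \<and>
     (\<forall>c v w. smooth_fun_on M (cdom M c) (\<lambda>p. omega M c p v w)) \<and>
     (\<forall>c. \<forall>p \<in> cdom M c. \<forall>u v w.
        diff_in M c (\<lambda>q. omega M c q v w) p u + diff_in M c (\<lambda>q. omega M c q w u) p v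
          + diff_in M c (\<lambda>q. omega M c q u v) p w = 0) \<and>
     (\<forall>c. \<forall>p \<in> cdom M c. \<forall>v w. omega M c p (\<i> *s v) (\<i> *s w) = omega M c p v w) \<and>
     (\<forall>c. \<forall>p \<in> cdom M c. \<forall>v. v \<noteq> 0 \<longrightarrow> 0 < omega M c p v (\<i> *s v))"

definition ham_field ::
    "('a, 'n::finite, 'c, 'z) kaehler_data_scheme \<Rightarrow> ('a \<Rightarrow> real) \<Rightarrow> 'c \<Rightarrow> 'a \<Rightarrow> complex^'n" where
  "ham_field M u c p = (THE v. \<forall>w. omega M c p v w = diff_in M c u p w)"

definition real_poisson ::
    "('a, 'n::finite, 'c, 'z) kaehler_data_scheme \<Rightarrow> ('a \<Rightarrow> real) \<Rightarrow> ('a \<Rightarrow> real) \<Rightarrow> 'a \<Rightarrow> real" where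
  "real_poisson M u v p =
     (let c = chart_at M p in omega M c p (ham_field M u c p) (ham_field M v c p))"

text \<open>
  Complex-valued functions: \<open>X\<^sub>f = X\<^bsub>Re f\<^esub> + \<i> X\<^bsub>Im f\<^esub>\<close>, and the form is extended complex bilinearly.
\<close>
definition poisson ::
    "('a, 'n::finite, 'c, 'z) kaehler_data_scheme \<Rightarrow> ('a \<Rightarrow> complex) \<Rightarrow> ('a \<Rightarrow> complex) \<Rightarrow> 'a \<Rightarrow> complex" where
  "poisson M f g p = Complex
     (real_poisson M (\<lambda>q. Re (f q)) (\<lambda>q. Re (g q)) p - real_poisson M (\<lambda>q. Im (f q)) (\<lambda>q. Im (g q)) p)
     (real_poisson M (\<lambda>q. Re (f q)) (\<lambda>q. Im (g q)) p + real_poisson M (\<lambda>q. Im (f q)) (\<lambda>q. Re (g q)) p)"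

text \<open>
  With \<open>z\<^sub>k = x\<^sub>k + \<i> y\<^sub>k\<close> the coordinates of the chart \<open>c\<close>, \<open>real_frame (k, False)\<close> is the vector of \<open>x\<^sub>k\<close> and
  \<open>real_frame (k, True)\<close> that of \<open>y\<^sub>k\<close>. The sum over permutations is the value of the \<open>n\<close>-th exterior power of
  the form on the frame \<open>(x\<^sub>1, y\<^sub>1, \<dots>, x\<^sub>n, y\<^sub>n)\<close>. As the frame comes in pairs, no ordering of \<open>'n\<close> is needed.
\<close>
definition real_frame :: "'n::finite \<times> bool \<Rightarrow> complex^'n" where
  "real_frame kb = axis (fst kb) (if snd kb then \<i> else 1)"

definition omega_power :: "('a, 'n::finite, 'c, 'z) kaehler_data_scheme \<Rightarrow> 'c \<Rightarrow> 'a \<Rightarrow> real" where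
  "omega_power M c p =
     (\<Sum>\<sigma> | \<sigma> permutes (UNIV :: ('n \<times> bool) set).
        of_int (sign \<sigma>) *
        (\<Prod>k\<in>UNIV. omega M c p (real_frame (\<sigma> (k, False))) (real_frame (\<sigma> (k, True))))) / 2 ^ CARD('n)"

text \<open>
  The volume form is \<open>\<omega>\<^sup>n / n!\<close>. It is positive in charts, and the measure is determined by this condition.
\<close>
definition liouville_volume :: "('a::t2_space, 'n::finite, 'c, 'z) kaehler_data_scheme \<Rightarrow> bool" where
  "liouville_volume M \<longleftrightarrow>
     sets (vol M) = sets borel \<and>
     (\<forall>c. \<forall>B \<in> sets borel. B \<subseteq> cdom M c \<longrightarrow>
        emeasure (vol M) B =
          (\<integral>\<^sup>+ x \<in> chart M c ` B. ennreal (omega_power M c (inv_chart M c x) / fact CARD('n)) \<partial>lborel))"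


section \<open>Quantum line bundle\<close>

text \<open>
  A line bundle \<open>L\<close> is given by holomorphic frames \<open>e\<^sub>i\<close> over the members \<open>tdom Q i\<close> of an open cover, with
  \<open>e\<^sub>j = cocycle Q i j \<cdot> e\<^sub>i\<close>. A section \<open>s\<close> of the \<open>m\<close>-th tensor power is the family of its components
  \<open>s i\<close> with respect to the frames \<open>e\<^sub>i\<^sup>m\<close>. Vanishing of \<open>s i\<close> off \<open>tdom Q i\<close> makes it unique.
  \<open>herm Q i = h(e\<^sub>i, e\<^sub>i)\<close>, and \<open>conn Q X s\<close> is \<open>\<nabla>\<^sub>X s\<close>.
\<close>
record ('a, 'n::finite, 'c, 'i) quantum_data = "('a, 'n, 'c) kaehler_data" +
  tdom :: "'i \<Rightarrow> 'a set"
  cocycle :: "'i \<Rightarrow> 'i \<Rightarrow> 'a \<Rightarrow> complex"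
  herm :: "'i \<Rightarrow> 'a \<Rightarrow> real"
  conn :: "('c \<Rightarrow> 'a \<Rightarrow> complex^'n) \<Rightarrow> ('i \<Rightarrow> 'a \<Rightarrow> complex) \<Rightarrow> 'i \<Rightarrow> 'a \<Rightarrow> complex"

definition holomorphic_line_bundle :: "('a::t2_space, 'n::finite, 'c, 'i) quantum_data \<Rightarrow> bool" where
  "holomorphic_line_bundle Q \<longleftrightarrow>
     (\<Union>i. tdom Q i) = UNIV \<and> (\<forall>i. open (tdom Q i)) \<and>
     (\<forall>i j. holo_fun_on Q (tdom Q i \<inter> tdom Q j) (cocycle Q i j)) \<and>
     (\<forall>i. \<forall>p \<in> tdom Q i. cocycle Q i i p = 1) \<and>
     (\<forall>i j k. \<forall>p \<in> tdom Q i \<inter> tdom Q j \<inter> tdom Q k.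
        cocycle Q i j p * cocycle Q j k p = cocycle Q i k p)"

definition power_sections :: "('a, 'n::finite, 'c, 'i) quantum_data \<Rightarrow> nat \<Rightarrow> ('i \<Rightarrow> 'a \<Rightarrow> complex) set" where
  "power_sections Q m =
     {s. (\<forall>i j. \<forall>p \<in> tdom Q i \<inter> tdom Q j. s i p = cocycle Q i j p ^ m * s j p) \<and>
         (\<forall>i. \<forall>p. p \<notin> tdom Q i \<longrightarrow> s i p = 0)}"

definition smooth_sections :: "('a, 'n::finite, 'c, 'i) quantum_data \<Rightarrow> nat \<Rightarrow> ('i \<Rightarrow> 'a \<Rightarrow> complex) set" where
  "smooth_sections Q m = {s \<in> power_sections Q m. \<forall>i. smooth_fun_on Q (tdom Q i) (s i)}"

definition holo_sections :: "('a, 'n::finite, 'c, 'i) quantum_data \<Rightarrow> nat \<Rightarrow> ('i \<Rightarrow> 'a \<Rightarrow> complex) set" where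
  "holo_sections Q m = {s \<in> power_sections Q m. \<forall>i. holo_fun_on Q (tdom Q i) (s i)}"

definition hermitian_metric :: "('a, 'n::finite, 'c, 'i) quantum_data \<Rightarrow> bool" where
  "hermitian_metric Q \<longleftrightarrow>
     (\<forall>i. smooth_fun_on Q (tdom Q i) (herm Q i) \<and> (\<forall>p \<in> tdom Q i. 0 < herm Q i p)) \<and>
     (\<forall>i j. \<forall>p \<in> tdom Q i \<inter> tdom Q j. herm Q j p = (cmod (cocycle Q i j p))\<^sup>2 * herm Q i p)"

definition triv_at :: "('a, 'n::finite, 'c, 'i) quantum_data \<Rightarrow> 'a \<Rightarrow> 'i" where
  "triv_at Q p = (SOME i. p \<in> tdom Q i)"

text \<open>The metric induced on the \<open>m\<close>-th tensor power.\<close>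
definition hprod ::
    "('a, 'n::finite, 'c, 'i) quantum_data \<Rightarrow> nat \<Rightarrow> ('i \<Rightarrow> 'a \<Rightarrow> complex) \<Rightarrow> ('i \<Rightarrow> 'a \<Rightarrow> complex) \<Rightarrow> 'a \<Rightarrow> complex" where
  "hprod Q m s t p =
     (let i = triv_at Q p in cnj (s i p) * t i p * of_real (herm Q i p ^ m))"

definition connection :: "('a, 'n::finite, 'c, 'i) quantum_data \<Rightarrow> bool" where
  "connection Q \<longleftrightarrow>
     (\<forall>X s. vector_field Q X \<longrightarrow> s \<in> smooth_sections Q 1 \<longrightarrow> conn Q X s \<in> smooth_sections Q 1) \<and>
     (\<forall>X Y s. vector_field Q X \<longrightarrow> vector_field Q Y \<longrightarrow> s \<in> smooth_sections Q 1 \<longrightarrow>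
        conn Q (\<lambda>c p. X c p + Y c p) s = (\<lambda>i p. conn Q X s i p + conn Q Y s i p)) \<and>
     (\<forall>X (u :: 'a \<Rightarrow> real) s. vector_field Q X \<longrightarrow> smooth_fun Q u \<longrightarrow> s \<in> smooth_sections Q 1 \<longrightarrow>
        conn Q (\<lambda>c p. u p *\<^sub>R X c p) s = (\<lambda>i p. of_real (u p) * conn Q X s i p)) \<and>
     (\<forall>X s t. vector_field Q X \<longrightarrow> s \<in> smooth_sections Q 1 \<longrightarrow> t \<in> smooth_sections Q 1 \<longrightarrow>
        conn Q X (\<lambda>i p. s i p + t i p) = (\<lambda>i p. conn Q X s i p + conn Q X t i p)) \<and>
     (\<forall>X (f :: 'a \<Rightarrow> complex) s. vector_field Q X \<longrightarrow> smooth_fun Q f \<longrightarrow> s \<in> smooth_sections Q 1 \<longrightarrow>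
        conn Q X (\<lambda>i p. f p * s i p) = (\<lambda>i p. f p * conn Q X s i p + vf_apply Q X f p * s i p))"

definition metric_compatible :: "('a, 'n::finite, 'c, 'i) quantum_data \<Rightarrow> bool" where
  "metric_compatible Q \<longleftrightarrow>
     (\<forall>X. \<forall>s \<in> smooth_sections Q 1. \<forall>t \<in> smooth_sections Q 1. vector_field Q X \<longrightarrow>
        vf_apply Q X (hprod Q 1 s t) = (\<lambda>p. hprod Q 1 (conn Q X s) t p + hprod Q 1 s (conn Q X t) p))"

text \<open>
  The \<open>(0,1)\<close>-part of the connection is the Cauchy-Riemann operator of \<open>L\<close>, which acts on components in
  holomorphic frames. Both sides are evaluated on \<open>X + \<i> J X\<close>, which is twice the \<open>(0,1)\<close>-part of \<open>X\<close>.
\<close>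
definition complex_compatible :: "('a, 'n::finite, 'c, 'i) quantum_data \<Rightarrow> bool" where
  "complex_compatible Q \<longleftrightarrow>
     (\<forall>X. \<forall>s \<in> smooth_sections Q 1. vector_field Q X \<longrightarrow>
        (\<forall>i. \<forall>p \<in> tdom Q i.
           conn Q X s i p + \<i> * conn Q (vf_J X) s i p =
           vf_apply Q X (s i) p + \<i> * vf_apply Q (vf_J X) (s i) p))"

definition prequantum_curvature :: "('a, 'n::finite, 'c, 'i) quantum_data \<Rightarrow> bool" where
  "prequantum_curvature Q \<longleftrightarrow>
     (\<forall>X Y. \<forall>s \<in> smooth_sections Q 1. vector_field Q X \<longrightarrow> vector_field Q Y \<longrightarrow>
        (\<forall>i p. conn Q X (conn Q Y s) i p - conn Q Y (conn Q X s) i p - conn Q (lie_bracket Q X Y) s i p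
           = - \<i> * of_real (let c = chart_at Q p in omega Q c p (X c p) (Y c p)) * s i p))"

definition quantum_line_bundle :: "('a::t2_space, 'n::finite, 'c, 'i) quantum_data \<Rightarrow> bool" where
  "quantum_line_bundle Q \<longleftrightarrow>
     holomorphic_line_bundle Q \<and> hermitian_metric Q \<and> connection Q \<and>
     metric_compatible Q \<and> complex_compatible Q \<and> prequantum_curvature Q"

text \<open>
  A basis \<open>s\<^sub>0, \<dots>, s\<^sub>N\<close> of the holomorphic sections defines an embedding \<open>p \<mapsto> [s\<^sub>0(p) : \<dots> : s\<^sub>N(p)]\<close> into
  projective space. The last three clauses say that this map is well defined, injective and an
  immersion (its differential in the affine chart \<open>\<zeta>\<^sub>k \<noteq> 0\<close> of projective space is injective). On a
  compact manifold an injective immersion is an embedding.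
\<close>
definition very_ample :: "('a, 'n::finite, 'c, 'i) quantum_data \<Rightarrow> bool" where
  "very_ample Q \<longleftrightarrow>
     (\<exists>N (s :: nat \<Rightarrow> 'i \<Rightarrow> 'a \<Rightarrow> complex).
        (\<forall>j\<le>N. s j \<in> holo_sections Q 1) \<and>
        (\<forall>t \<in> holo_sections Q 1. \<exists>!a. (\<forall>j>N. a j = 0) \<and> t = (\<lambda>i p. \<Sum>j\<le>N. a j * s j i p)) \<and>
        (\<forall>i. \<forall>p \<in> tdom Q i. \<exists>j\<le>N. s j i p \<noteq> 0) \<and>
        (\<forall>i i'. \<forall>p \<in> tdom Q i. \<forall>q \<in> tdom Q i'. \<forall>z.
           z \<noteq> 0 \<and> (\<forall>j\<le>N. s j i p = z * s j i' q) \<longrightarrow> p = q) \<and>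
        (\<forall>i c. \<forall>p \<in> tdom Q i \<inter> cdom Q c. \<forall>k\<le>N. s k i p \<noteq> 0 \<longrightarrow>
           (\<forall>v. v \<noteq> 0 \<longrightarrow> (\<exists>j\<le>N. diff_in Q c (\<lambda>q. s j i q / s k i q) p v \<noteq> 0))))"


section \<open>Berezin-Toeplitz operators\<close>

definition scalar_product ::
    "('a, 'n::finite, 'c, 'i) quantum_data \<Rightarrow> nat \<Rightarrow> ('i \<Rightarrow> 'a \<Rightarrow> complex) \<Rightarrow> ('i \<Rightarrow> 'a \<Rightarrow> complex) \<Rightarrow> complex" where
  "scalar_product Q m s t = (LINT p|vol Q. hprod Q m s t p)"

definition section_norm ::
    "('a, 'n::finite, 'c, 'i) quantum_data \<Rightarrow> nat \<Rightarrow> ('i \<Rightarrow> 'a \<Rightarrow> complex) \<Rightarrow> real" where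
  "section_norm Q m s = sqrt (Re (scalar_product Q m s s))"

text \<open>Orthogonal projection onto the holomorphic sections; meaningful for square-integrable \<open>s\<close>.\<close>
definition holo_proj ::
    "('a, 'n::finite, 'c, 'i) quantum_data \<Rightarrow> nat \<Rightarrow> ('i \<Rightarrow> 'a \<Rightarrow> complex) \<Rightarrow> 'i \<Rightarrow> 'a \<Rightarrow> complex" where
  "holo_proj Q m s =
     (THE t. t \<in> holo_sections Q m \<and>
        (\<forall>r \<in> holo_sections Q m. scalar_product Q m r (\<lambda>i p. s i p - t i p) = 0))"

definition toeplitz ::
    "('a, 'n::finite, 'c, 'i) quantum_data \<Rightarrow> nat \<Rightarrow> ('a \<Rightarrow> complex) \<Rightarrow> ('i \<Rightarrow> 'a \<Rightarrow> complex) \<Rightarrow> 'i \<Rightarrow> 'a \<Rightarrow> complex" where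
  "toeplitz Q m f s = holo_proj Q m (\<lambda>i p. f p * s i p)"

text \<open>Operator norm on the finite-dimensional space of holomorphic sections.\<close>
definition op_norm ::
    "('a, 'n::finite, 'c, 'i) quantum_data \<Rightarrow> nat
      \<Rightarrow> (('i \<Rightarrow> 'a \<Rightarrow> complex) \<Rightarrow> 'i \<Rightarrow> 'a \<Rightarrow> complex) \<Rightarrow> real" where
  "op_norm Q m A = Sup {section_norm Q m (A s) | s. s \<in> holo_sections Q m \<and> section_norm Q m s \<le> 1}"


section \<open>Star products\<close>

text \<open>A formal power series in \<open>\<nu>\<close> with coefficients in functions is the sequence of its coefficients.\<close>
type_synonym 'a fun_series = "nat \<Rightarrow> 'a \<Rightarrow> complex"

definition const_series :: "('a \<Rightarrow> complex) \<Rightarrow> 'a fun_series" where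
  "const_series f = (\<lambda>r p. if r = 0 then f p else 0)"

text \<open>
  The \<open>r\<close>-th coefficient collects the terms with \<open>j + k + l = r\<close>. Bilinearity over formal power series
  is built in, given bilinear coefficients \<open>C j\<close>.
\<close>
definition star ::
    "(nat \<Rightarrow> ('a \<Rightarrow> complex) \<Rightarrow> ('a \<Rightarrow> complex) \<Rightarrow> 'a \<Rightarrow> complex) \<Rightarrow> 'a fun_series \<Rightarrow> 'a fun_series \<Rightarrow> 'a fun_series" where
  "star C F G = (\<lambda>r p. \<Sum>j\<le>r. \<Sum>k\<le>r - j. C j (F k) (G (r - j - k)) p)"

text \<open>The values of \<open>C j\<close> at functions that are not smooth are irrelevant throughout.\<close>
definition star_product ::
    "('a, 'n::finite, 'c, 'z) kaehler_data_scheme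
      \<Rightarrow> (nat \<Rightarrow> ('a \<Rightarrow> complex) \<Rightarrow> ('a \<Rightarrow> complex) \<Rightarrow> 'a \<Rightarrow> complex) \<Rightarrow> bool" where
  "star_product M C \<longleftrightarrow>
     (\<forall>j f g. smooth_fun M f \<longrightarrow> smooth_fun M g \<longrightarrow> smooth_fun M (C j f g)) \<and>
     (\<forall>j f g h a b. smooth_fun M f \<longrightarrow> smooth_fun M g \<longrightarrow> smooth_fun M h \<longrightarrow>
        C j (\<lambda>p. a * f p + b * g p) h = (\<lambda>p. a * C j f h p + b * C j g h p) \<and>
        C j h (\<lambda>p. a * f p + b * g p) = (\<lambda>p. a * C j h f p + b * C j h g p)) \<and>
     (\<forall>F G H. (\<forall>k. smooth_fun M (F k) \<and> smooth_fun M (G k) \<and> smooth_fun M (H k)) \<longrightarrow>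
        star C (star C F G) H = star C F (star C G H)) \<and>
     (\<forall>f g. smooth_fun M f \<longrightarrow> smooth_fun M g \<longrightarrow>
        C 0 f g = (\<lambda>p. f p * g p) \<and>
        (\<lambda>p. C 1 f g p - C 1 g f p) = (\<lambda>p. - \<i> * poisson M f g p))"

definition toeplitz_asymptotics ::
    "('a, 'n::finite, 'c, 'i) quantum_data
      \<Rightarrow> (nat \<Rightarrow> ('a \<Rightarrow> complex) \<Rightarrow> ('a \<Rightarrow> complex) \<Rightarrow> 'a \<Rightarrow> complex) \<Rightarrow> bool" where
  "toeplitz_asymptotics Q C \<longleftrightarrow>
     (\<forall>f g N. smooth_fun Q f \<longrightarrow> smooth_fun Q g \<longrightarrow> 1 \<le> N \<longrightarrow>
        (\<exists>K. \<forall>m\<ge>1.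
           op_norm Q m (\<lambda>s i p. toeplitz Q m f (toeplitz Q m g s) i p
             - (\<Sum>j<N. of_real (1 / real m ^ j) * toeplitz Q m (C j f g) s i p)) \<le> K * (1 / real m ^ N)))"

text \<open>
  \<open>C\<close> is the sequence of coefficients of the Berezin-Toeplitz star product, that is, of the unique star
  product with these asymptotics. Uniqueness refers to the coefficients as maps on smooth functions.
\<close>
definition berezin_toeplitz_star_product ::
    "('a, 'n::finite, 'c, 'i) quantum_data
      \<Rightarrow> (nat \<Rightarrow> ('a \<Rightarrow> complex) \<Rightarrow> ('a \<Rightarrow> complex) \<Rightarrow> 'a \<Rightarrow> complex) \<Rightarrow> bool" where
  "berezin_toeplitz_star_product Q C \<longleftrightarrow>
     star_product Q C \<and> toeplitz_asymptotics Q C \<and>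
     (\<forall>C'. star_product Q C' \<longrightarrow> toeplitz_asymptotics Q C' \<longrightarrow>
        (\<forall>j f g. smooth_fun Q f \<longrightarrow> smooth_fun Q g \<longrightarrow> C' j f g = C j f g))"

end

theory Submission
  imports Defs "HOL-Complex_Analysis.Conformal_Mappings"
begin

text \<open>
  Since \<open>T\<^sub>1\<close> is the identity, \<open>1 \<star> g\<close> and \<open>g \<star> 1\<close> have the same Toeplitz asymptotics as \<open>g\<close>. Instead of
  recovering functions from the norms of their Toeplitz operators, the proof exploits the uniqueness of the
  star product. Formally, \<open>\<star>\<close> has a unit \<open>e = 1 + O(\<nu>)\<close>, and \<open>1\<close> has an inverse \<open>b\<close>. Then
  \<open>f \<star>' g = f \<star> b \<star> g\<close> is a star product with unit \<open>1\<close>. Put \<open>x = f \<star> b\<close>, so that \<open>x \<star> 1 = f\<close>. As \<open>T\<^sub>g\<close> is bounded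
  uniformly in \<open>m\<close>, up to any order \<open>T\<^bsub>x \<star> g\<^esub> \<sim> T\<^sub>x T\<^sub>g = T\<^sub>x T\<^sub>1 T\<^sub>g \<sim> T\<^bsub>x \<star> 1\<^esub> T\<^sub>g = T\<^sub>f T\<^sub>g\<close>, hence \<open>\<star>'\<close> is the
  Berezin-Toeplitz star product, too, and \<open>\<star>' = \<star>\<close>.

  The analytic part is that Toeplitz operators are well defined. The Liouville volume is positive
  on open sets because the Pfaffian of a Kaehler form is positive, by unitary diagonalization.
  Orthogonal projections onto holomorphic sections exist because finitely many point
  evaluations separate them: by the Schwarz lemma a section vanishing at \<open>p\<close> is at most half its maximum
  near \<open>p\<close>, so that one vanishing at suitable finitely many points is zero.
\<close>

section \<open>Algebra of star products\<close>

text \<open>The product \<open>f \<star> b \<star> g\<close> comes from transport of structure.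
  Right multiplication by \<open>b\<close> is an invertible linear map on formal series, with
  inverse the right multiplication by 1, and (F \<star>' G) \<star> b = (F \<star> b) \<star> (G
  \<star> b). Hence \<star>' is associative, and its unit is the element that is sent to
  \<open>e\<close>, namely 1. Appealing to uniqueness has a price: the competitor must satisfy every
  clause of a star product. The delicate clause is the Poisson bracket at order \<nu>, because the
  twist changes the first-order coefficient. It survives since associativity forces C_1(1, g) to be
  \<open>g\<close> times a fixed function. On the analytic side the projection is a definite
  description and the operator norm a supremum. Remainders can be added and composed only once
  projections are known to exist and Toeplitz operators to be bounded, with one bound for all
  \<open>m\<close>. From then on only estimates of squared norms are manipulated.\<close>

lemma Ck_on_cong:
  fixes f g :: "'a::real_normed_vector \<Rightarrow> 'b::real_normed_vector"
  assumes "open S" "\<And>x. x \<in> S \<Longrightarrow> f x = g x"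
  shows "Ck_on k S f \<longleftrightarrow> Ck_on k S g"
  using assms(2)
proof (induction k arbitrary: f g)
  case 0
  then show ?case by (simp cong: continuous_on_cong)
next
  case (Suc k)
  have D: "(f has_derivative D) (at x) \<longleftrightarrow> (g has_derivative D) (at x)" if "x \<in> S" for x D
    using Suc.prems assms(1) that by (metis has_derivative_transform_within_open)
  then have "frechet_derivative f (at x) = frechet_derivative g (at x)" if "x \<in> S" for x
    using that by (simp add: frechet_derivative_def)
  then have "Ck_on k S (\<lambda>x. frechet_derivative f (at x) v) \<longleftrightarrow> Ck_on k S (\<lambda>x. frechet_derivative g (at x) v)" for v
    by (intro Suc.IH) (simp only:)
  moreover have "f differentiable at x within S \<longleftrightarrow> g differentiable at x within S" if "x \<in> S" for x
    unfolding differentiable_def at_within_open[OF that \<open>open S\<close>] by (simp only: D[OF that])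
  then have "f differentiable_on S \<longleftrightarrow> g differentiable_on S"
    by (simp add: differentiable_on_def)
  ultimately show ?case by simp
qed

text \<open>Closure under linear combinations suffices: the other smooth functions that get
  constructed are constants and values of \<open>C j\<close>, smooth by hypothesis.\<close>

lemma Ck_on_lincomb:
  fixes f g :: "'a::real_normed_vector \<Rightarrow> complex"
  assumes "open S" "Ck_on k S f" "Ck_on k S g"
  shows "Ck_on k S (\<lambda>x. a * f x + b * g x)"
  using assms(2,3)
proof (induction k arbitrary: f g)
  case 0
  then show ?case by (auto intro!: continuous_intros)
next
  case (Suc k)
  let ?h = "\<lambda>x. a * f x + b * g x"
  have D: "frechet_derivative ?h (at x) = (\<lambda>v. a * frechet_derivative f (at x) v + b * frechet_derivative g (at x) v)"
    if "x \<in> S" for x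
  proof -
    have "f differentiable (at x)" "g differentiable (at x)"
      using Suc.prems that at_within_open[OF that \<open>open S\<close>] by (auto simp: differentiable_on_def dest!: bspec[OF _ that])
    then have "(f has_derivative frechet_derivative f (at x)) (at x)"
      "(g has_derivative frechet_derivative g (at x)) (at x)"
      by (simp_all add: frechet_derivative_works)
    then have "(?h has_derivative (\<lambda>v. a * frechet_derivative f (at x) v + b * frechet_derivative g (at x) v)) (at x)"
      by (intro has_derivative_add has_derivative_mult_right)
    then show ?thesis by (rule frechet_derivative_at[symmetric])
  qed
  have "Ck_on k S (\<lambda>x. frechet_derivative ?h (at x) v)" for v
    using Suc.IH[of "\<lambda>x. frechet_derivative f (at x) v" "\<lambda>x. frechet_derivative g (at x) v"] Suc.prems
    by (subst Ck_on_cong[OF \<open>open S\<close>]) (auto simp: D)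
  moreover have "?h differentiable_on S"
    using Suc.prems by (intro differentiable_on_add differentiable_on_mult differentiable_on_const) simp_all
  ultimately show ?case by simp
qed

lemma Ck_on_const: "Ck_on k S (\<lambda>_. c)"
  by (induction k arbitrary: c) (auto simp: frechet_derivative_const)

lemma open_chart_image:
  assumes "complex_manifold M" "open V"
  shows "open (chart M c ` (cdom M c \<inter> V))"
proof -
  have "openin (top_of_set (cdom M c)) (cdom M c \<inter> V)"
    using assms(2) by (simp add: openin_open_Int)
  moreover have "homeomorphism (cdom M c) (chart M c ` cdom M c) (chart M c) (inv_chart M c)"
    and "open (chart M c ` cdom M c)"
    using assms(1) by (auto simp: complex_manifold_def)
  ultimately show ?thesis
    by (metis homeomorphism_imp_open_map openin_open_eq)
qed

lemma smooth_fun_on_lincomb: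
  fixes f g :: "_ \<Rightarrow> complex"
  assumes "complex_manifold M" "open V" "smooth_fun_on M V f" "smooth_fun_on M V g"
  shows "smooth_fun_on M V (\<lambda>p. a * f p + b * g p)"
  using assms Ck_on_lincomb[OF open_chart_image[OF assms(1,2)]]
  by (auto simp: smooth_fun_on_def smooth_on_def)

lemma smooth_fun_on_const: "smooth_fun_on M V (\<lambda>_. c)"
  by (simp add: smooth_fun_on_def smooth_on_def Ck_on_const)

lemma sum_triangle_swap:
  "(\<Sum>j\<le>r. \<Sum>k\<le>r - j. a j k) = (\<Sum>k\<le>r. \<Sum>j\<le>r - k. a j (k::nat) :: 'b::comm_monoid_add)"
  unfolding sum.Sigma[OF finite_atMost ballI[OF finite_atMost]]
  by (rule sum.reindex_bij_witness[of _ "\<lambda>(x, y). (y, x)" "\<lambda>(x, y). (y, x)"]) auto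

section \<open>Coefficients of products of formal series\<close>

locale star_algebra =
  fixes M :: "('a::t2_space, 'n::finite, 'c, 'z) kaehler_data_scheme"
    and C :: "nat \<Rightarrow> ('a \<Rightarrow> complex) \<Rightarrow> ('a \<Rightarrow> complex) \<Rightarrow> 'a \<Rightarrow> complex"
  assumes manifold: "complex_manifold M"
    and star_product: "star_product M C"
begin

abbreviation smooth_series :: "'a fun_series \<Rightarrow> bool" where
  "smooth_series F \<equiv> \<forall>k. smooth_fun M (F k)"

abbreviation st (infixl "\<star>" 70) where
  "F \<star> G \<equiv> star C F G"

lemma smooth_lincomb:
  "smooth_fun M f \<Longrightarrow> smooth_fun M g \<Longrightarrow> smooth_fun M (\<lambda>p. a * f p + b * g p :: complex)"
  using smooth_fun_on_lincomb[OF manifold open_UNIV] .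

lemma smooth_sum:
  assumes "finite A" "\<And>x. x \<in> A \<Longrightarrow> smooth_fun M (f x)"
  shows "smooth_fun M (\<lambda>p. \<Sum>x\<in>A. f x p :: complex)"
  using assms
proof (induction A rule: finite_induct)
  case empty
  then show ?case by (simp add: smooth_fun_on_const)
next
  case (insert x A)
  then show ?case
    using smooth_lincomb[of "f x" "\<lambda>p. \<Sum>x\<in>A. f x p" 1 1] by auto
qed

lemmas star_product_unfolded = star_product[unfolded star_product_def]

lemma C_smooth: "smooth_fun M f \<Longrightarrow> smooth_fun M g \<Longrightarrow> smooth_fun M (C j f g)"
  by (rule star_product_unfolded[THEN conjunct1, rule_format])

lemma C_lincomb:
  assumes "smooth_fun M f" "smooth_fun M g" "smooth_fun M h"
  shows "C j (\<lambda>p. a * f p + b * g p) h = (\<lambda>p. a * C j f h p + b * C j g h p)"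
    and "C j h (\<lambda>p. a * f p + b * g p) = (\<lambda>p. a * C j h f p + b * C j h g p)"
  using star_product_unfolded[THEN conjunct2, THEN conjunct1, rule_format, OF assms, of j a b]
  by (rule conjunct1, rule conjunct2)

lemma C_0: "smooth_fun M f \<Longrightarrow> smooth_fun M g \<Longrightarrow> C 0 f g = (\<lambda>p. f p * g p)"
  by (rule star_product_unfolded[THEN conjunct2, THEN conjunct2, THEN conjunct2, rule_format, THEN conjunct1])

lemma C_1: "smooth_fun M f \<Longrightarrow> smooth_fun M g \<Longrightarrow> C 1 f g p - C 1 g f p = - \<i> * poisson M f g p"
  by (rule star_product_unfolded[THEN conjunct2, THEN conjunct2, THEN conjunct2, rule_format, THEN conjunct2, THEN fun_cong])

lemma star_assoc:
  "smooth_series F \<Longrightarrow> smooth_series G \<Longrightarrow> smooth_series H \<Longrightarrow> F \<star> G \<star> H = F \<star> (G \<star> H)"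
  by (rule star_product_unfolded[THEN conjunct2, THEN conjunct2, THEN conjunct1, rule_format]) simp

lemma C_zero: "smooth_fun M g \<Longrightarrow> C j (\<lambda>_. 0) g = (\<lambda>_. 0)" "smooth_fun M g \<Longrightarrow> C j g (\<lambda>_. 0) = (\<lambda>_. 0)"
  using C_lincomb[of g g g j 0 0] by simp_all

lemma smooth_const_series: "smooth_fun M f \<Longrightarrow> smooth_series (const_series f)"
  unfolding const_series_def
  by (intro allI, rename_tac k, case_tac "k = 0") (simp_all add: smooth_fun_on_const)

lemma const_series_simps: "const_series f 0 = f" "k \<noteq> 0 \<Longrightarrow> const_series f k = (\<lambda>_. 0)"
  by (auto simp: const_series_def)

lemma star_smooth: "smooth_series F \<Longrightarrow> smooth_series G \<Longrightarrow> smooth_series (F \<star> G)"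
  unfolding star_def by (intro allI smooth_sum C_smooth) auto

lemma star_const_left:
  assumes "smooth_fun M f" "smooth_series G"
  shows "(const_series f \<star> G) r p = (\<Sum>j\<le>r. C j f (G (r - j)) p)"
proof -
  have "(\<Sum>k\<le>r - j. C j (const_series f k) (G (r - j - k)) p) = C j f (G (r - j)) p" for j
  proof -
    have "(\<Sum>k\<le>r - j. C j (const_series f k) (G (r - j - k)) p)
      = (\<Sum>k\<in>{0}. C j (const_series f k) (G (r - j - k)) p)"
      by (rule sum.mono_neutral_right) (auto simp: const_series_simps C_zero assms)
    then show ?thesis by (simp add: const_series_simps)
  qed
  then show ?thesis by (simp add: star_def)
qed

lemma star_const_right:
  assumes "smooth_series F" "smooth_fun M g"
  shows "(F \<star> const_series g) r p = (\<Sum>j\<le>r. C j (F (r - j)) g p)"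
proof -
  have "(\<Sum>k\<le>r - j. C j (F k) (const_series g (r - j - k)) p) = C j (F (r - j)) g p" for j
  proof -
    have "C j (F k) (const_series g (r - j - k)) p = 0" if "k \<le> r - j" "k \<noteq> r - j" for k
      using const_series_simps(2)[of "r - j - k" g] that assms by (simp add: C_zero)
    then have "(\<Sum>k\<le>r - j. C j (F k) (const_series g (r - j - k)) p)
      = (\<Sum>k\<in>{r - j}. C j (F k) (const_series g (r - j - k)) p)"
      by (intro sum.mono_neutral_right) auto
    then show ?thesis by (simp add: const_series_simps)
  qed
  then show ?thesis by (simp add: star_def)
qed

lemma star_const_const:
  assumes "smooth_fun M f" "smooth_fun M g"
  shows "(const_series f \<star> const_series g) r = C r f g"
proof
  fix p
  have "C j f (const_series g (r - j)) p = 0" if "j \<le> r" "j \<noteq> r" for j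
    using const_series_simps(2)[of "r - j" g] that assms by (simp add: C_zero)
  then have "(\<Sum>j\<le>r. C j f (const_series g (r - j)) p) = (\<Sum>j\<in>{r}. C j f (const_series g (r - j)) p)"
    by (intro sum.mono_neutral_right) auto
  then show "(const_series f \<star> const_series g) r p = C r f g p"
    using assms by (simp add: star_const_left smooth_const_series const_series_simps)
qed

text \<open>Linearity over formal series: \<open>F\<close> is the sum of the \<nu>^k
  \<open>F k\<close>, and a factor \<nu>^k shifts the order by \<open>k\<close>. Together with its
  mirror image this reduces products of series to products of functions.\<close>

lemma star_expand_left:
  assumes "smooth_series F" "smooth_series G"
  shows "(F \<star> G) r p = (\<Sum>k\<le>r. (const_series (F k) \<star> G) (r - k) p)"
proof -
  have "(F \<star> G) r p = (\<Sum>k\<le>r. \<Sum>j\<le>r - k. C j (F k) (G (r - j - k)) p)"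
    unfolding star_def by (rule sum_triangle_swap)
  then show ?thesis
    using assms by (simp add: star_const_left add.commute)
qed

lemma star_expand_right:
  assumes "smooth_series F" "smooth_series G"
  shows "(F \<star> G) r p = (\<Sum>l\<le>r. (F \<star> const_series (G l)) (r - l) p)"
proof -
  have "(\<Sum>k\<le>r - j. C j (F k) (G (r - j - k)) p) = (\<Sum>l\<le>r - j. C j (F (r - j - l)) (G l) p)" for j
    by (rule sum.reindex_bij_witness[of _ "\<lambda>l. r - j - l" "\<lambda>l. r - j - l"]) (auto simp del: diff_diff_left)
  then have "(F \<star> G) r p = (\<Sum>j\<le>r. \<Sum>l\<le>r - j. C j (F (r - j - l)) (G l) p)"
    by (simp add: star_def)
  also have "\<dots> = (\<Sum>l\<le>r. \<Sum>j\<le>r - l. C j (F (r - j - l)) (G l) p)"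
    by (rule sum_triangle_swap)
  finally show ?thesis
    using assms by (simp add: star_const_right add.commute)
qed

lemma star_lincomb:
  assumes "smooth_series F" "smooth_series G" "smooth_series H"
  shows "star C (\<lambda>r p. a * F r p + b * G r p) H = (\<lambda>r p. a * (F \<star> H) r p + b * (G \<star> H) r p)"
    and "star C H (\<lambda>r p. a * F r p + b * G r p) = (\<lambda>r p. a * (H \<star> F) r p + b * (H \<star> G) r p)"
  using assms by (simp_all add: star_def C_lincomb sum.distrib sum_distrib_left)

lemma const_series_lincomb:
  "const_series (\<lambda>p. a * f p + b * g p) = (\<lambda>r p. a * const_series f r p + b * const_series g r p)"
  by (auto simp: const_series_def fun_eq_iff)

section \<open>Unit of the star product and inverse of the constant function 1\<close>

abbreviation one :: "'a fun_series" where
  "one \<equiv> const_series (\<lambda>_. 1)"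

lemma smooth_one: "smooth_series one"
  by (intro smooth_const_series smooth_fun_on_const)

text \<open>The term \<open>j = 0\<close> is pointwise multiplication by 1. The rest involves only
  coefficients of \<open>F\<close> below \<open>r\<close>, so multiplication by 1 is triangular with
  identity diagonal: it can be cancelled and solved order by order.\<close>

lemma one_star:
  assumes "smooth_series F"
  shows "(one \<star> F) r p = F r p + (\<Sum>j=1..r. C j (\<lambda>_. 1) (F (r - j)) p)"
proof -
  have "(one \<star> F) r p = (\<Sum>j\<le>r. C j (\<lambda>_. 1) (F (r - j)) p)"
    using assms by (intro star_const_left smooth_fun_on_const)
  also have "\<dots> = C 0 (\<lambda>_. 1) (F r) p + (\<Sum>j=1..r. C j (\<lambda>_. 1) (F (r - j)) p)"
    by (simp add: atMost_atLeast0 sum.atLeast_Suc_atMost)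
  finally show ?thesis using assms by (simp add: C_0 smooth_fun_on_const)
qed

lemma star_one:
  assumes "smooth_series F"
  shows "(F \<star> one) r p = F r p + (\<Sum>j=1..r. C j (F (r - j)) (\<lambda>_. 1) p)"
proof -
  have "(F \<star> one) r p = (\<Sum>j\<le>r. C j (F (r - j)) (\<lambda>_. 1) p)"
    using assms by (intro star_const_right smooth_fun_on_const)
  also have "\<dots> = C 0 (F r) (\<lambda>_. 1) p + (\<Sum>j=1..r. C j (F (r - j)) (\<lambda>_. 1) p)"
    by (simp add: atMost_atLeast0 sum.atLeast_Suc_atMost)
  finally show ?thesis using assms by (simp add: C_0 smooth_fun_on_const)
qed

lemma one_star_inject:
  assumes "smooth_series F" "smooth_series G" "one \<star> F = one \<star> G"
  shows "F = G"
proof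
  fix r
  show "F r = G r"
  proof (induction r rule: less_induct)
    case (less r)
    show ?case
    proof
      fix p
      have "(\<Sum>j=1..r. C j (\<lambda>_. 1) (F (r - j)) p) = (\<Sum>j=1..r. C j (\<lambda>_. 1) (G (r - j)) p)"
        by (intro sum.cong) (auto simp: less)
      then show "F r p = G r p"
        using one_star[OF assms(1), of r p] one_star[OF assms(2), of r p] assms(3) by simp
    qed
  qed
qed

lemma star_one_inject:
  assumes "smooth_series F" "smooth_series G" "F \<star> one = G \<star> one"
  shows "F = G"
proof
  fix r
  show "F r = G r"
  proof (induction r rule: less_induct)
    case (less r)
    show ?case
    proof
      fix p
      have "(\<Sum>j=1..r. C j (F (r - j)) (\<lambda>_. 1) p) = (\<Sum>j=1..r. C j (G (r - j)) (\<lambda>_. 1) p)"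
        by (intro sum.cong) (auto simp: less)
      then show "F r p = G r p"
        using star_one[OF assms(1), of r p] star_one[OF assms(2), of r p] assms(3) by simp
    qed
  qed
qed

text \<open>Recursive solution \<open>X\<close> of \<open>one \<star> X = G\<close>. The conditional
  repeats the range of the sum so that the recursive call sees \<open>1 \<le> j \<le> r\<close>,
  which termination needs.\<close>

fun one_ldiv :: "'a fun_series \<Rightarrow> 'a fun_series" where
  "one_ldiv G r = (\<lambda>p. G r p - (\<Sum>j\<in>{1..r}. if j \<in> {1..r} then C j (\<lambda>_. 1) (one_ldiv G (r - j)) p else 0))"

declare one_ldiv.simps [simp del]

lemma one_ldiv:
  assumes "smooth_series G"
  shows "smooth_series (one_ldiv G)" and "one \<star> one_ldiv G = G"
proof -
  have eq: "one_ldiv G r = (\<lambda>p. 1 * G r p + (-1) * (\<Sum>j\<in>{1..r}. C j (\<lambda>_. 1) (one_ldiv G (r - j)) p))" for r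
    by (subst one_ldiv.simps) (auto intro!: ext sum.cong)
  have "smooth_fun M (one_ldiv G r)" for r
  proof (induction r rule: less_induct)
    case (less r)
    show ?case unfolding eq[of r]
      using assms less by (intro smooth_lincomb smooth_sum C_smooth smooth_fun_on_const) auto
  qed
  then show S: "smooth_series (one_ldiv G)" by simp
  have "(one \<star> one_ldiv G) r p = G r p" for r p
    unfolding one_star[OF S] eq[of r] by simp
  then show "one \<star> one_ldiv G = G" by blast
qed

text \<open>Solving \<open>one \<star> e = one\<close> already yields a two-sided unit, since by
  associativity \<open>e\<close> is absorbed next to 1 and 1 can be cancelled on either
  side.\<close>

definition unit :: "'a fun_series" where
  "unit = one_ldiv one"

definition one_inv :: "'a fun_series" where
  "one_inv = one_ldiv unit"

lemma smooth_unit: "smooth_series unit"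
  unfolding unit_def by (intro one_ldiv smooth_one)

lemma smooth_one_inv: "smooth_series one_inv"
  unfolding one_inv_def by (intro one_ldiv smooth_unit)

lemma one_star_unit: "one \<star> unit = one"
  unfolding unit_def by (intro one_ldiv smooth_one)

lemma one_star_one_inv: "one \<star> one_inv = unit"
  unfolding one_inv_def by (intro one_ldiv smooth_unit)

lemma unit_star:
  assumes "smooth_series F"
  shows "unit \<star> F = F"
proof (rule one_star_inject)
  show "one \<star> (unit \<star> F) = one \<star> F"
    using star_assoc[OF smooth_one smooth_unit assms] by (simp add: one_star_unit)
qed (auto intro: star_smooth[rule_format] smooth_unit[rule_format] simp: assms)

lemma star_unit:
  assumes "smooth_series F"
  shows "F \<star> unit = F"
proof (rule star_one_inject)
  show "F \<star> unit \<star> one = F \<star> one"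
    using star_assoc[OF assms smooth_unit smooth_one] by (simp add: unit_star[OF smooth_one])
qed (auto intro: star_smooth[rule_format] smooth_unit[rule_format] simp: assms)

text \<open>A right inverse of 1 is a left inverse as well: multiplied by 1 from the left, both
  sides become 1, and 1 can be cancelled.\<close>

lemma one_inv_star_one: "one_inv \<star> one = unit"
proof (rule one_star_inject)
  show "one \<star> (one_inv \<star> one) = one \<star> unit"
    using star_assoc[OF smooth_one smooth_one_inv smooth_one]
    by (simp add: one_star_one_inv one_star_unit unit_star[OF smooth_one])
qed (auto intro: star_smooth[rule_format] smooth_unit[rule_format] smooth_one_inv[rule_format] smooth_one[rule_format])

section \<open>The twisted star product\<close>

definition twisted :: "nat \<Rightarrow> ('a \<Rightarrow> complex) \<Rightarrow> ('a \<Rightarrow> complex) \<Rightarrow> 'a \<Rightarrow> complex" where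
  "twisted j f g = (const_series f \<star> one_inv \<star> const_series g) j"

lemma smooth_star_one_inv: "smooth_series F \<Longrightarrow> smooth_series (F \<star> one_inv)"
  by (intro star_smooth smooth_one_inv)

text \<open>The twist is defined on functions only. Expanding both factors carries the formula over
  to series, and associativity of the twist becomes that of \<star>.\<close>

lemma star_twisted:
  assumes "smooth_series F" "smooth_series G"
  shows "star twisted F G = F \<star> one_inv \<star> G"
proof (intro ext)
  fix r p
  have sF: "smooth_series (const_series (F k) \<star> one_inv)" for k
    by (intro smooth_star_one_inv smooth_const_series assms(1)[rule_format])
  have "(F \<star> one_inv \<star> G) r p = (F \<star> (one_inv \<star> G)) r p"
    using assms by (simp add: star_assoc smooth_one_inv)
  also have "\<dots> = (\<Sum>k\<le>r. (const_series (F k) \<star> (one_inv \<star> G)) (r - k) p)"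
    using assms by (intro star_expand_left star_smooth smooth_one_inv)
  also have "\<dots> = (\<Sum>k\<le>r. (const_series (F k) \<star> one_inv \<star> G) (r - k) p)"
    using assms by (simp add: star_assoc smooth_one_inv smooth_const_series)
  also have "\<dots> = (\<Sum>k\<le>r. \<Sum>l\<le>r - k. twisted (r - k - l) (F k) (G l) p)"
    unfolding twisted_def using star_expand_right[OF sF assms(2)] by simp
  also have "\<dots> = (\<Sum>k\<le>r. \<Sum>j\<le>r - k. twisted j (F k) (G (r - j - k)) p)"
  proof (rule sum.cong[OF refl])
    fix k
    show "(\<Sum>l\<le>r - k. twisted (r - k - l) (F k) (G l) p) = (\<Sum>j\<le>r - k. twisted j (F k) (G (r - j - k)) p)"
      unfolding diff_commute[of r _ k]
      by (rule sum.reindex_bij_witness[of _ "\<lambda>j. r - k - j" "\<lambda>j. r - k - j"]) (auto simp del: diff_diff_left)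
  qed
  also have "\<dots> = star twisted F G r p"
    unfolding star_def by (rule sum_triangle_swap[symmetric])
  finally show "star twisted F G r p = (F \<star> one_inv \<star> G) r p" ..
qed

lemma one_inv_0: "one_inv 0 = (\<lambda>_. 1)"
proof
  fix p
  have "unit 0 p = 1"
    using one_star[OF smooth_unit, of 0 p] by (simp add: one_star_unit const_series_simps)
  then show "one_inv 0 p = 1"
    using one_star[OF smooth_one_inv, of 0 p] by (simp add: one_star_one_inv)
qed

lemma star_0: "smooth_series F \<Longrightarrow> smooth_series G \<Longrightarrow> (F \<star> G) 0 = (\<lambda>p. F 0 p * G 0 p)"
  by (auto simp: star_def C_0)

lemma star_1:
  assumes "smooth_series F" "smooth_series G"
  shows "(F \<star> G) (Suc 0) p = F 0 p * G (Suc 0) p + F (Suc 0) p * G 0 p + C 1 (F 0) (G 0) p"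
  using assms by (simp add: star_def C_0)

text \<open>The coefficient of \<open>\<nu>\<close> in \<open>(1 \<star> 1) \<star> g = 1 \<star> (1 \<star> g)\<close>.\<close>
lemma C_1_one:
  assumes "smooth_fun M g"
  shows "C 1 (\<lambda>_. 1) g p = C 1 (\<lambda>_. 1) (\<lambda>_. 1) p * g p"
proof -
  let ?g = "const_series g"
  note s = smooth_one smooth_const_series[OF assms]
  have s1: "smooth_series (one \<star> one)" "smooth_series (one \<star> ?g)"
    using s by (simp_all add: star_smooth)
  have "(one \<star> one \<star> ?g) (Suc 0) p = (one \<star> (one \<star> ?g)) (Suc 0) p"
    using s by (simp add: star_assoc)
  then show ?thesis
    using s s1 by (simp add: star_1 star_0 const_series_simps)
qed

lemma twisted_star_product: "star_product M twisted"
  unfolding star_product_def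
proof (intro conjI allI impI)
  fix f g :: "'a \<Rightarrow> complex" and j
  assume "smooth_fun M f" "smooth_fun M g"
  then show "smooth_fun M (twisted j f g)"
    unfolding twisted_def by (intro star_smooth[rule_format] smooth_one_inv[rule_format] smooth_const_series[rule_format])
next
  fix j a b and f g h :: "'a \<Rightarrow> complex"
  assume s: "smooth_fun M f" "smooth_fun M g" "smooth_fun M h"
  note s' = s[THEN smooth_const_series]
  note s'' = s'[THEN smooth_star_one_inv]
  show "twisted j (\<lambda>p. a * f p + b * g p) h = (\<lambda>p. a * twisted j f h p + b * twisted j g h p)"
    unfolding twisted_def const_series_lincomb
    by (simp only: star_lincomb[OF s'(1,2) smooth_one_inv] star_lincomb[OF s''(1,2) s'(3)])
  show "twisted j h (\<lambda>p. a * f p + b * g p) = (\<lambda>p. a * twisted j h f p + b * twisted j h g p)"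
    unfolding twisted_def const_series_lincomb
    by (simp only: star_lincomb[OF s'(1,2) s''(3)])
next
  fix F G H :: "'a fun_series"
  assume "\<forall>k. smooth_fun M (F k) \<and> smooth_fun M (G k) \<and> smooth_fun M (H k)"
  then have s: "smooth_series F" "smooth_series G" "smooth_series H"
    by auto
  note s' = s[THEN smooth_star_one_inv]
  have "star twisted (star twisted F G) H = F \<star> one_inv \<star> G \<star> one_inv \<star> H"
    by (simp add: star_twisted s s' star_smooth)
  also have "\<dots> = F \<star> one_inv \<star> (G \<star> one_inv) \<star> H"
    by (simp add: star_assoc s s' star_smooth smooth_one_inv)
  also have "\<dots> = F \<star> one_inv \<star> (G \<star> one_inv \<star> H)"
    by (rule star_assoc[OF s'(1,2) s(3)])
  also have "\<dots> = star twisted F (star twisted G H)"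
    by (simp add: star_twisted s s' star_smooth)
  finally show "star twisted (star twisted F G) H = star twisted F (star twisted G H)" .
next
  fix f g :: "'a \<Rightarrow> complex"
  assume s: "smooth_fun M f" "smooth_fun M g"
  note s' = s[THEN smooth_const_series]
  show "twisted 0 f g = (\<lambda>p. f p * g p)"
    unfolding twisted_def
    by (simp add: star_0 s' smooth_star_one_inv smooth_one_inv const_series_simps one_inv_0)
  \<comment> \<open>By \<open>C_1_one\<close> the summand added to \<open>C 1 f g\<close> is
    \<open>f g\<close> times a function independent of \<open>f\<close> and \<open>g\<close>. It is
    symmetric and drops out of the commutator.\<close>
  have tw: "twisted (Suc 0) f g p = f p * (g p * one_inv (Suc 0) p + C 1 (\<lambda>_. 1) g p) + C 1 f g p"
    if "smooth_fun M f" "smooth_fun M g" for f g p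
  proof -
    note s' = that[THEN smooth_const_series]
    have "twisted (Suc 0) f g = (const_series f \<star> (one_inv \<star> const_series g)) (Suc 0)"
      unfolding twisted_def by (simp add: star_assoc s' smooth_one_inv)
    then show ?thesis
      by (simp add: star_1 star_0 s' star_smooth smooth_one_inv const_series_simps one_inv_0)
  qed
  show "(\<lambda>p. twisted 1 f g p - twisted 1 g f p) = (\<lambda>p. - \<i> * poisson M f g p)"
  proof
    fix p
    show "twisted 1 f g p - twisted 1 g f p = - \<i> * poisson M f g p"
      using tw[of f g p] tw[of g f p] C_1_one[of f p] C_1_one[of g p] C_1[of f g p] s
      by (simp add: algebra_simps)
  qed
qed

lemma twisted_unit:
  assumes "smooth_fun M g"
  shows "twisted k (\<lambda>_. 1) g = const_series g k" and "twisted k g (\<lambda>_. 1) = const_series g k"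
proof -
  note s = smooth_const_series[OF assms]
  show "twisted k (\<lambda>_. 1) g = const_series g k"
    unfolding twisted_def by (simp add: one_star_one_inv unit_star[OF s])
  show "twisted k g (\<lambda>_. 1) = const_series g k"
    unfolding twisted_def
    by (simp add: star_assoc smooth_one_inv smooth_one s one_inv_star_one star_unit[OF s])
qed

end

section \<open>Positivity of the Liouville volume form\<close>

text \<open>For alternating \<open>w\<close> this is 2^n n! times the Pfaffian of the Gram matrix of
  \<open>F\<close>, where n is \<open>CARD('n)\<close>. The family \<open>F\<close> is arbitrary so
  that elementary operations on frames can be expressed.\<close>

definition pairing_sum :: "('v \<Rightarrow> 'v \<Rightarrow> real) \<Rightarrow> ('n::finite \<times> bool \<Rightarrow> 'v) \<Rightarrow> real" where
  "pairing_sum w F = (\<Sum>\<sigma> | \<sigma> permutes (UNIV :: ('n \<times> bool) set).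
     of_int (sign \<sigma>) * (\<Prod>k\<in>UNIV. w (F (\<sigma> (k, False))) (F (\<sigma> (k, True)))))"

text \<open>Composing \<sigma> with the transposition of \<open>i\<close> and \<open>j\<close> keeps
  every product and reverses every sign, so the sum equals its negative.\<close>

lemma pairing_sum_eq_0:
  fixes F :: "'n::finite \<times> bool \<Rightarrow> 'v"
  assumes "i \<noteq> j" "F i = F j"
  shows "pairing_sum w F = 0"
proof -
  let ?t = "Transposition.transpose i j"
  have F: "F (?t x) = F x" for x
    using assms by (auto simp: Transposition.transpose_def)
  have t: "?t permutes UNIV" by (rule permutes_swap_id) auto
  have "pairing_sum w F = (\<Sum>\<sigma> | \<sigma> permutes (UNIV :: ('n \<times> bool) set).
      of_int (sign (?t \<circ> \<sigma>)) * (\<Prod>k\<in>UNIV. w (F ((?t \<circ> \<sigma>) (k, False))) (F ((?t \<circ> \<sigma>) (k, True)))))"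
    unfolding pairing_sum_def
    by (subst setum_permutations_compose_left[OF t]) simp
  also have "\<dots> = - pairing_sum w F"
    unfolding pairing_sum_def sum_negf[symmetric]
  proof (rule sum.cong[OF refl])
    fix \<sigma> :: "'n \<times> bool \<Rightarrow> 'n \<times> bool" assume sigma: "\<sigma> \<in> {\<sigma>. \<sigma> permutes UNIV}"
    then have "sign (?t \<circ> \<sigma>) = - sign \<sigma>"
      using assms(1) by (simp add: sign_compose permutation_swap_id permutes_imp_permutation[OF finite] sign_swap_id)
    then show "of_int (sign (?t \<circ> \<sigma>)) * (\<Prod>k\<in>UNIV. w (F ((?t \<circ> \<sigma>) (k, False))) (F ((?t \<circ> \<sigma>) (k, True))))
      = - (of_int (sign \<sigma>) * (\<Prod>k\<in>UNIV. w (F (\<sigma> (k, False))) (F (\<sigma> (k, True)))))"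
      by (simp add: F)
  qed
  finally show ?thesis by simp
qed

text \<open>Every permutation puts \<open>i\<close> into exactly one slot of exactly one factor, and
  that factor is linear in the vector at \<open>i\<close>.\<close>

lemma pairing_sum_add:
  fixes F :: "'n::finite \<times> bool \<Rightarrow> 'v::real_vector"
  assumes w: "bilinear w"
  shows "pairing_sum w (F(i := x + c *\<^sub>R y)) = pairing_sum w (F(i := x)) + c * pairing_sum w (F(i := y))"
  unfolding pairing_sum_def sum_distrib_left sum.distrib[symmetric]
proof (rule sum.cong[OF refl])
  fix \<sigma> :: "'n \<times> bool \<Rightarrow> 'n \<times> bool" assume sigma: "\<sigma> \<in> {\<sigma>. \<sigma> permutes UNIV}"
  then have inj: "\<sigma> a = \<sigma> b \<longleftrightarrow> a = b" for a b
    by (auto dest: permutes_inj simp: inj_eq)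
  have "i \<in> range \<sigma>"
    using sigma by (simp add: permutes_surj)
  then obtain l where l: "\<sigma> l = i" by blast
  define G where "G z k = w ((F(i := z)) (\<sigma> (k, False))) ((F(i := z)) (\<sigma> (k, True)))" for z k
  have split: "(\<Prod>k\<in>UNIV. G z k) = G z (fst l) * (\<Prod>k\<in>UNIV - {fst l}. G x k)" for z
  proof -
    have "(\<Prod>k\<in>UNIV - {fst l}. G z k) = (\<Prod>k\<in>UNIV - {fst l}. G x k)"
      by (rule prod.cong) (auto simp: G_def l[symmetric] inj)
    then show ?thesis by (simp add: prod.remove[of UNIV "fst l"])
  qed
  have "G (x + c *\<^sub>R y) (fst l) = G x (fst l) + c * G y (fst l)"
    by (cases l; cases "snd l")
      (auto simp: G_def l[symmetric] inj bilinear_radd[OF w] bilinear_ladd[OF w] bilinear_lmul[OF w] bilinear_rmul[OF w])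
  then show "of_int (sign \<sigma>) * (\<Prod>k\<in>UNIV. w ((F(i := x + c *\<^sub>R y)) (\<sigma> (k, False))) ((F(i := x + c *\<^sub>R y)) (\<sigma> (k, True))))
    = of_int (sign \<sigma>) * (\<Prod>k\<in>UNIV. w ((F(i := x)) (\<sigma> (k, False))) ((F(i := x)) (\<sigma> (k, True))))
      + c * (of_int (sign \<sigma>) * (\<Prod>k\<in>UNIV. w ((F(i := y)) (\<sigma> (k, False))) ((F(i := y)) (\<sigma> (k, True)))))"
    unfolding G_def[symmetric] split by (simp add: algebra_simps)
qed

text \<open>By linearity at \<open>i\<close> the additional term is a sum with \<open>F j\<close> in
  two places, which vanishes.\<close>

lemma pairing_sum_transvection:
  fixes F :: "'n::finite \<times> bool \<Rightarrow> 'v::real_vector"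
  assumes "bilinear w" "i \<noteq> j"
  shows "pairing_sum w (F(i := F i + c *\<^sub>R F j)) = pairing_sum w F"
  using pairing_sum_add[OF assms(1), of F i "F i" c "F j"] pairing_sum_eq_0[OF assms(2), of "F(i := F j)" w] assms(2)
  by simp

text \<open>\<sigma> is \<pi> on one half composed with \<pi> on the other half. Exchanging the
  halves conjugates these two permutations, so they have the same sign and the product of the signs
  is 1.\<close>

lemma sign_block_permutation:
  fixes \<sigma> :: "'n::finite \<times> bool \<Rightarrow> 'n \<times> bool"
  assumes "\<sigma> permutes UNIV" "\<And>k b. \<sigma> (k, b) = (\<pi> k, b)"
  shows "sign \<sigma> = 1"
proof -
  define half where "half b x = (if snd x = b then (\<pi> (fst x), b) else x)" for b and x :: "'n \<times> bool"
  define flip where "flip x = (fst x, \<not> snd x)" for x :: "'n \<times> bool"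
  have \<pi>: "\<pi> a = \<pi> b \<Longrightarrow> a = b" for a b
    using permutes_inj[OF assms(1)] assms(2)[of a True] assms(2)[of b True] by (metis injD prod.inject)
  have "inj (half b)" for b
    by (rule injI) (auto simp: half_def prod_eq_iff split: if_splits dest: \<pi>)
  then have half: "permutation (half b)" for b
    by (simp add: permutation_bijective finite_UNIV_inj_surj permutation bij_def)
  have "inj flip"
    by (rule injI) (auto simp: flip_def prod_eq_iff)
  then have flip: "permutation flip"
    by (simp add: finite_UNIV_inj_surj permutation bij_def)
  have "half True = flip \<circ> half False \<circ> flip"
    by (auto simp: fun_eq_iff half_def flip_def)
  then have "sign (half True) = sign flip * sign (half False) * sign flip"
    using half flip by (simp add: sign_compose permutation_compose)
  moreover have "\<sigma> = half False \<circ> half True"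
    by (auto simp: fun_eq_iff half_def assms(2))
  ultimately have "sign \<sigma> = (sign (half False) * sign (half False)) * (sign flip * sign flip)"
    using half by (simp add: sign_compose mult.assoc mult.left_commute)
  then show ?thesis by (simp only: sign_idempotent mult_1)
qed

section \<open>Unitary diagonalization of a positive form of type (1,1)\<close>

locale positive_form =
  fixes w :: "complex^'n::finite \<Rightarrow> complex^'n \<Rightarrow> real"
  assumes bil: "bilinear w"
    and alternating: "w v v = 0"
    and invariant: "w (\<i> *s v) (\<i> *s u) = w v u"
    and positive: "v \<noteq> 0 \<Longrightarrow> 0 < w v (\<i> *s v)"
begin

lemmas w_simps = bilinear_radd[OF bil] bilinear_ladd[OF bil] bilinear_lmul[OF bil] bilinear_rmul[OF bil]
  bilinear_lsub[OF bil] bilinear_rsub[OF bil] bilinear_lneg[OF bil] bilinear_rneg[OF bil]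
  bilinear_lzero[OF bil] bilinear_rzero[OF bil]

lemma i_i: "\<i> *s (\<i> *s (v :: complex^'n)) = - v"
  by (simp add: vec_eq_iff)

lemma complex_scale: "c *s (v :: complex^'n) = Re c *\<^sub>R v + Im c *\<^sub>R (\<i> *s v)"
  by (auto simp: vec_eq_iff complex_eq_iff)

lemma i_scale: "\<i> *s (c *s (v :: complex^'n)) = Re c *\<^sub>R (\<i> *s v) - Im c *\<^sub>R v"
  by (auto simp: vec_eq_iff complex_eq_iff)

lemma skew: "w u v = - w v u"
  using alternating[of "u + v"] unfolding w_simps by (simp add: alternating)

lemma skew_i: "w u (\<i> *s v) = w v (\<i> *s u)"
  using invariant[of u "\<i> *s v"] skew[of "\<i> *s u" v] by (simp add: i_i w_simps)

definition frame :: "('n \<Rightarrow> complex^'n) \<Rightarrow> 'n \<times> bool \<Rightarrow> complex^'n" where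
  "frame e x = (if snd x then \<i> *s e (fst x) else e (fst x))"

definition indep :: "('n \<Rightarrow> complex^'n) \<Rightarrow> bool" where
  "indep e \<longleftrightarrow> (\<forall>x. (\<Sum>k\<in>UNIV. x k *s e k) = 0 \<longrightarrow> (\<forall>k. x k = 0))"

text \<open>Vanishing of the Hermitian product: its real part is the Riemannian product
  \<open>w u (\<i> *s v)\<close>, its imaginary part is \<open>w u v\<close> up to sign.\<close>

definition orth :: "complex^'n \<Rightarrow> complex^'n \<Rightarrow> bool" where
  "orth u v \<longleftrightarrow> w u v = 0 \<and> w u (\<i> *s v) = 0"

lemma orth_sym: "orth u v \<Longrightarrow> orth v u"
  using skew[of u v] skew_i[of u v] by (auto simp: orth_def)

lemma orth_scale: "orth u v \<Longrightarrow> orth u (c *s v)"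
  unfolding orth_def i_scale unfolding complex_scale[of c v] by (simp add: w_simps)

lemma orth_diff: "orth u v \<Longrightarrow> orth u v' \<Longrightarrow> orth u (v - v')"
  by (simp add: orth_def vector_ssub_ldistrib w_simps)

lemma indep_nonzero:
  assumes "indep e" shows "e k \<noteq> 0"
proof
  assume "e k = 0"
  then have "(\<Sum>j\<in>UNIV. (if j = k then 1 else 0) *s e j) = 0"
    by (intro sum.neutral) auto
  then have "(if k = k then 1 else 0 :: complex) = 0"
    using assms[unfolded indep_def, rule_format, of "\<lambda>j. if j = k then 1 else 0" k] by simp
  then show False by simp
qed

text \<open>Subtracting a complex multiple of \<open>e k\<close> moves both \<open>e j\<close> and
  \<open>\<i> *s e j\<close>. Splitting \<open>c\<close> into real and imaginary part gives two real
  transvections for each of them, with the coefficients below.\<close>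

lemma pairing_sum_frame_update:
  assumes "j \<noteq> k"
  shows "pairing_sum w (frame (e(j := e j - c *s e k))) = pairing_sum w (frame e)"
proof -
  let ?F = "frame e"
  define F1 where "F1 = ?F((j, False) := ?F (j, False) + (- Re c) *\<^sub>R ?F (k, False))"
  define F2 where "F2 = F1((j, False) := F1 (j, False) + (- Im c) *\<^sub>R F1 (k, True))"
  define F3 where "F3 = F2((j, True) := F2 (j, True) + (- Re c) *\<^sub>R F2 (k, True))"
  define F4 where "F4 = F3((j, True) := F3 (j, True) + Im c *\<^sub>R F3 (k, False))"
  have "pairing_sum w F4 = pairing_sum w F3" "pairing_sum w F3 = pairing_sum w F2"
    "pairing_sum w F2 = pairing_sum w F1" "pairing_sum w F1 = pairing_sum w ?F"
    unfolding F1_def F2_def F3_def F4_def using assms by (intro pairing_sum_transvection bil; simp)+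
  moreover have "frame (e(j := e j - c *s e k)) = F4"
  proof
    fix x :: "'n \<times> bool"
    show "frame (e(j := e j - c *s e k)) x = F4 x"
      using assms by (cases x; cases "snd x")
        (auto simp: F1_def F2_def F3_def F4_def frame_def vec_eq_iff complex_eq_iff algebra_simps)
  qed
  ultimately show ?thesis by simp
qed

lemma indep_update:
  assumes "indep e" "j \<noteq> k"
  shows "indep (e(j := e j - c *s e k))"
  unfolding indep_def
proof (intro allI impI)
  fix x l
  let ?e = "e(j := e j - c *s e k)"
  \<comment> \<open>The coefficients of the same vector with respect to the old family.\<close>
  define y where "y = x(k := x k - c * x j)"
  assume "(\<Sum>l\<in>UNIV. x l *s ?e l) = 0"
  moreover have "(\<Sum>l\<in>UNIV. x l *s ?e l) = (\<Sum>l\<in>UNIV. x l *s e l - (if l = j then (x j * c) *s e k else 0))"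
    by (rule sum.cong) (auto simp: vec_eq_iff algebra_simps)
  moreover have "(\<Sum>l\<in>UNIV. y l *s e l) = (\<Sum>l\<in>UNIV. x l *s e l - (if l = k then (x j * c) *s e k else 0))"
    by (rule sum.cong) (auto simp: y_def vec_eq_iff algebra_simps)
  ultimately have "(\<Sum>l\<in>UNIV. y l *s e l) = 0"
    by (simp add: sum_subtractf)
  then have y: "y l = 0" for l
    using assms(1) by (simp add: indep_def)
  have "x l = 0" if "l \<noteq> k" for l
    using y[of l] that by (simp add: y_def)
  moreover have "x k = 0"
    using y[of k] calculation[OF assms(2)] by (simp add: y_def)
  ultimately show "x l = 0" by metis
qed

lemma orth_eliminate:
  assumes "u \<noteq> 0"
  obtains c where "orth u (v - c *s u)"
proof -
  define h where "h = w u (\<i> *s u)"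
  have "h \<noteq> 0" using positive[OF assms] by (simp add: h_def)
  \<comment> \<open>The Gram-Schmidt coefficient: orthogonality amounts to the two real equations
    \<open>w u (\<i> *s v) = Re c * h\<close> and \<open>w u v = Im c * h\<close>.\<close>
  define c where "c = Complex (w u (\<i> *s v) / h) (w u v / h)"
  have "orth u (v - c *s u)"
    using \<open>h \<noteq> 0\<close> unfolding orth_def vector_ssub_ldistrib i_scale
    by (simp add: complex_scale[of c u] w_simps alternating h_def[symmetric]) (simp add: c_def)
  then show ?thesis by (rule that)
qed

text \<open>One pass of Gram-Schmidt with pivot \<open>e k\<close>, an index \<open>j\<close> at a
  time. Vectors with index in \<open>A\<close> are left alone; they stay orthogonal to the new
  \<open>e j\<close> because they are orthogonal to both the old \<open>e j\<close> and
  \<open>e k\<close>.\<close>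

lemma orth_frame_step:
  assumes "finite B" "k \<notin> B" "k \<notin> A" "indep e" "\<And>a l. a \<in> A \<Longrightarrow> l \<noteq> a \<Longrightarrow> orth (e a) (e l)"
  shows "\<exists>e'. pairing_sum w (frame e') = pairing_sum w (frame e) \<and> indep e' \<and>
    (\<forall>a\<in>A. \<forall>l. l \<noteq> a \<longrightarrow> orth (e' a) (e' l)) \<and> (\<forall>l\<in>B. orth (e' k) (e' l))"
  using assms(1,2)
proof (induction B rule: finite_induct)
  case empty
  then show ?case using assms by auto
next
  case (insert j B)
  then obtain e' where e': "pairing_sum w (frame e') = pairing_sum w (frame e)" "indep e'"
    "\<And>a l. a \<in> A \<Longrightarrow> l \<noteq> a \<Longrightarrow> orth (e' a) (e' l)" "\<And>l. l \<in> B \<Longrightarrow> orth (e' k) (e' l)"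
    by auto
  have "j \<noteq> k" using insert by auto
  show ?case
  proof (cases "j \<in> A")
    case True
    then show ?thesis
      using e' orth_sym[OF e'(3)[OF True]] \<open>j \<noteq> k\<close> by (intro exI[of _ e']) auto
  next
    case False
    obtain c where c: "orth (e' k) (e' j - c *s e' k)"
      using orth_eliminate indep_nonzero[OF e'(2)] by metis
    let ?e = "e'(j := e' j - c *s e' k)"
    have "orth (?e a) (?e l)" if "a \<in> A" "l \<noteq> a" for a l
      using that False e'(3)[of a] e'(3)[of a k] assms(3) by (cases "a = k") (auto intro!: orth_diff orth_scale)
    moreover have "orth (?e k) (?e l)" if "l \<in> insert j B" for l
      using that c e'(4)[of l] \<open>j \<noteq> k\<close> by auto
    ultimately show ?thesis
      using e'(1) pairing_sum_frame_update[OF \<open>j \<noteq> k\<close>, of e' c] indep_update[OF e'(2) \<open>j \<noteq> k\<close>, of c]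
      by (intro exI[of _ ?e]) (simp del: fun_upd_apply)
  qed
qed

text \<open>Gram-Schmidt without normalization. As \<open>'n\<close> carries no order, the set
  \<open>A\<close> of finished pivots takes the place of an initial segment.\<close>

lemma orth_frame:
  assumes "finite A" "indep e"
  shows "\<exists>e'. pairing_sum w (frame e') = pairing_sum w (frame e) \<and> indep e' \<and>
    (\<forall>a\<in>A. \<forall>l. l \<noteq> a \<longrightarrow> orth (e' a) (e' l))"
  using assms(1)
proof (induction A rule: finite_induct)
  case empty
  then show ?case using assms by auto
next
  case (insert k A)
  then obtain e' where e': "pairing_sum w (frame e') = pairing_sum w (frame e)" "indep e'"
    "\<And>a l. a \<in> A \<Longrightarrow> l \<noteq> a \<Longrightarrow> orth (e' a) (e' l)"
    by auto
  obtain e'' where e'': "pairing_sum w (frame e'') = pairing_sum w (frame e')" "indep e''"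
    "\<forall>a\<in>A. \<forall>l. l \<noteq> a \<longrightarrow> orth (e'' a) (e'' l)" "\<forall>l\<in>-{k}. orth (e'' k) (e'' l)"
    using orth_frame_step[of "-{k}" k A e'] e' insert by auto
  then show ?case using e'(1) by (intro exI[of _ e'']) auto
qed

text \<open>Undoing the swap inside one pair reverses the sign of \<sigma> and, by skew symmetry,
  the sign of one factor. Without swapped pairs the sign is 1 and every factor has the form
  \<open>w v (\<i> *s v)\<close>; the induction is on the number of swapped pairs.\<close>

lemma block_term_pos:
  assumes e: "\<And>k. e k \<noteq> 0" and "\<sigma> permutes UNIV" and "\<And>k. fst (\<sigma> (k, False)) = fst (\<sigma> (k, True))"
  shows "0 < of_int (sign \<sigma>) * (\<Prod>k\<in>UNIV. w (frame e (\<sigma> (k, False))) (frame e (\<sigma> (k, True))))"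
  using assms(2,3)
proof (induction "card {k. snd (\<sigma> (k, False))}" arbitrary: \<sigma> rule: less_induct)
  case less
  have inj: "\<sigma> a = \<sigma> b \<longleftrightarrow> a = b" for a b
    using permutes_inj[OF less.prems(1)] by (simp add: inj_eq)
  have snd: "snd (\<sigma> (k, True)) \<longleftrightarrow> \<not> snd (\<sigma> (k, False))" for k
    using less.prems(2)[of k] inj[of "(k, True)" "(k, False)"] by (auto simp: prod_eq_iff)
  show ?case
  proof (cases "\<exists>k. snd (\<sigma> (k, False))")
    case False
    define \<pi> where "\<pi> k = fst (\<sigma> (k, False))" for k
    have \<sigma>: "\<sigma> (k, b) = (\<pi> k, b)" for k b
      using False snd[of k] less.prems(2)[of k] by (cases b) (auto simp: \<pi>_def prod_eq_iff)
    then have "sign \<sigma> = 1" using less.prems(1) by (rule sign_block_permutation[rotated])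
    then show ?thesis
      using e positive by (auto simp: \<sigma> frame_def intro!: prod_pos)
  next
    case True
    then obtain k where k: "snd (\<sigma> (k, False))" by blast
    let ?t = "Transposition.transpose (k, False) (k, True)"
    define \<tau> where "\<tau> = \<sigma> \<circ> ?t"
    have t: "?t permutes UNIV" by (rule permutes_swap_id) auto
    have \<tau>: "\<tau> permutes UNIV" unfolding \<tau>_def by (rule permutes_compose[OF t less.prems(1)])
    have \<tau>_other: "\<tau> (l, b) = \<sigma> (l, b)" if "l \<noteq> k" for l b
      using that by (simp add: \<tau>_def Transposition.transpose_def)
    have \<tau>_k: "\<tau> (k, b) = \<sigma> (k, \<not> b)" for b
      by (cases b) (auto simp: \<tau>_def Transposition.transpose_def)
    have "{l. snd (\<tau> (l, False))} = {l. snd (\<sigma> (l, False))} - {k}"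
      using \<tau>_other \<tau>_k k snd by (auto simp: set_eq_iff) metis+
    then have "card {l. snd (\<tau> (l, False))} < card {l. snd (\<sigma> (l, False))}"
      using k by (metis (mono_tags) card_Diff1_less finite mem_Collect_eq)
    moreover have "fst (\<tau> (l, False)) = fst (\<tau> (l, True))" for l
      using less.prems(2) by (cases "l = k") (auto simp: \<tau>_other \<tau>_k)
    ultimately have pos: "0 < of_int (sign \<tau>) * (\<Prod>l\<in>UNIV. w (frame e (\<tau> (l, False))) (frame e (\<tau> (l, True))))"
      using less.hyps \<tau> by blast
    have "sign \<tau> = - sign \<sigma>"
      using less.prems(1) unfolding \<tau>_def by (simp add: sign_compose permutation_swap_id permutes_imp_permutation[OF finite] sign_swap_id)
    moreover have "(\<Prod>l\<in>UNIV. w (frame e (\<tau> (l, False))) (frame e (\<tau> (l, True))))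
      = - (\<Prod>l\<in>UNIV. w (frame e (\<sigma> (l, False))) (frame e (\<sigma> (l, True))))"
    proof -
      have "(\<Prod>l\<in>UNIV - {k}. w (frame e (\<tau> (l, False))) (frame e (\<tau> (l, True))))
        = (\<Prod>l\<in>UNIV - {k}. w (frame e (\<sigma> (l, False))) (frame e (\<sigma> (l, True))))"
        by (rule prod.cong) (auto simp: \<tau>_other)
      then show ?thesis
        using skew[of "frame e (\<sigma> (k, True))" "frame e (\<sigma> (k, False))"]
        by (simp add: prod.remove[of UNIV k] \<tau>_k)
    qed
    ultimately show ?thesis using pos by simp
  qed
qed

text \<open>After orthogonalization, which keeps the sum, a permutation that separates some pair
  contributes 0 and all others contribute positively, the identity among them.\<close>

lemma pairing_sum_frame_pos:
  assumes "indep e"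
  shows "0 < pairing_sum w (frame e)"
proof -
  obtain e' where e': "pairing_sum w (frame e') = pairing_sum w (frame e)" "indep e'"
    "\<And>a l. l \<noteq> a \<Longrightarrow> orth (e' a) (e' l)"
    using orth_frame[OF finite assms, of UNIV] by auto
  define T where "T \<sigma> = of_int (sign \<sigma>) * (\<Prod>k\<in>UNIV. w (frame e' (\<sigma> (k, False))) (frame e' (\<sigma> (k, True))))"
    for \<sigma> :: "'n \<times> bool \<Rightarrow> 'n \<times> bool"
  note block = block_term_pos[of e', OF indep_nonzero[OF e'(2)], folded T_def]
  have "w (frame e' x) (frame e' y) = 0" if "fst x \<noteq> fst y" for x y
  proof -
    have "orth (e' (fst x)) (e' (fst y))"
      using e'(3) that by auto
    then have "w (e' (fst x)) (e' (fst y)) = 0" "w (e' (fst x)) (\<i> *s e' (fst y)) = 0"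
      "w (e' (fst y)) (\<i> *s e' (fst x)) = 0"
      using orth_sym unfolding orth_def by blast+
    then show ?thesis
      using skew[of "\<i> *s e' (fst x)" "e' (fst y)"] by (auto simp: frame_def invariant)
  qed
  then have "T \<sigma> = 0" if "fst (\<sigma> (k, False)) \<noteq> fst (\<sigma> (k, True))" for \<sigma> k
    unfolding T_def using that by (intro mult_eq_0_iff[THEN iffD2] disjI2 prod_zero bexI[of _ k]) simp_all
  then have nonneg: "0 \<le> T \<sigma>" if "\<sigma> permutes UNIV" for \<sigma>
    using block[OF that] by (cases "\<forall>k. fst (\<sigma> (k, False)) = fst (\<sigma> (k, True))") (auto intro: less_imp_le)
  have "0 < (\<Sum>\<sigma> | \<sigma> permutes (UNIV :: ('n \<times> bool) set). T \<sigma>)"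
  proof (rule sum_pos2[of _ id])
    show "0 < T id" by (rule block) (auto simp: permutes_id)
  qed (auto simp: permutes_id nonneg finite_permutations)
  then show ?thesis
    using e'(1) by (simp add: pairing_sum_def T_def)
qed

lemma pairing_sum_real_frame_pos: "0 < pairing_sum w real_frame"
proof -
  let ?e = "\<lambda>k::'n. axis k (1::complex)"
  have eq: "real_frame = frame ?e"
    by (auto simp: fun_eq_iff real_frame_def frame_def vec_eq_iff axis_def)
  moreover have "indep ?e"
    unfolding indep_def
  proof (intro allI impI)
    fix x k assume "(\<Sum>k\<in>UNIV. x k *s ?e k) = 0"
    moreover have "(\<Sum>k\<in>UNIV. x k *s ?e k) $ k = x k"
      by (simp add: axis_def if_distrib cong: if_cong)
    ultimately show "x k = 0" by simp
  qed
  ultimately show ?thesis unfolding eq by (intro pairing_sum_frame_pos)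
qed

end

lemma omega_power_pos:
  assumes "kaehler_form M" "p \<in> cdom M c"
  shows "0 < omega_power M c p"
proof -
  note k = assms(1)[unfolded kaehler_form_def]
  note k1 = k[THEN conjunct1, rule_format, OF assms(2)]
  note k5 = k[THEN conjunct2, THEN conjunct2, THEN conjunct2, THEN conjunct2]
  interpret positive_form "omega M c p"
    using k1 k5[THEN conjunct1, rule_format, OF assms(2)] k5[THEN conjunct2, rule_format, OF assms(2)]
    by unfold_locales simp_all
  show ?thesis
    using pairing_sum_real_frame_pos by (simp add: omega_power_def pairing_sum_def)
qed

section \<open>The Liouville measure\<close>

lemma norm_vector_smult: "norm (c *s (v :: complex^'n)) = cmod c * norm v"
  by (simp add: norm_vec_def L2_set_def norm_mult power_mult_distrib sum_distrib_left[symmetric] real_sqrt_mult)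

lemma holo_on_line:
  assumes "holo_on S f" "x + z *s v \<in> S"
  shows "\<exists>d. ((\<lambda>z. f (x + z *s v)) has_field_derivative d) (at z)"
proof -
  obtain D where D: "(f has_derivative D) (at (x + z *s v))" "\<And>v. D (\<i> *s v) = \<i> * D v"
    using assms unfolding holo_on_def by metis
  have "linear (\<lambda>h. h *s v)"
    by (auto simp: linear_iff vec_eq_iff algebra_simps)
  then have "((\<lambda>z. z *s v) has_derivative (\<lambda>h. h *s v)) (at z)"
    by (intro bounded_linear_imp_has_derivative) (simp add: linear_conv_bounded_linear)
  then have "((\<lambda>z. x + z *s v) has_derivative (\<lambda>h. h *s v)) (at z)"
    using has_derivative_add[OF has_derivative_const[of x]] by fastforce
  then have "((\<lambda>z. f (x + z *s v)) has_derivative (\<lambda>h. D (h *s v))) (at z)"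
    using D(1) by (rule has_derivative_compose)
  moreover have "D (h *s v) = D v * h" for h
  proof -
    interpret D: linear D using D(1) by (rule has_derivative_linear)
    have "h *s v = Re h *\<^sub>R v + Im h *\<^sub>R (\<i> *s v)"
      by (auto simp: vec_eq_iff complex_eq_iff)
    then have "D (h *s v) = (Re h + \<i> * Im h) * D v"
      by (simp add: D.add D.scaleR D(2) complex_eq_iff)
    then show ?thesis by (simp add: complex_eq[symmetric] mult.commute)
  qed
  ultimately show ?thesis
    by (auto simp: has_field_derivative_def)
qed

text \<open>The lemma in one variable, applied on the complex line through \<open>x\<close> and
  \<open>y\<close>. It wants values strictly inside the unit disc, hence the strict bound
  \<open>B\<close>.\<close>

lemma holo_on_Schwarz:
  assumes f: "holo_on S f" and S: "cball x r \<subseteq> S" and r: "0 < r" and "f x = 0"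
    and B: "\<And>y. y \<in> cball x r \<Longrightarrow> cmod (f y) < B" and y: "y \<in> ball x r"
  shows "cmod (f y) \<le> B * (dist x y / r)"
proof (cases "y = x")
  case True
  then show ?thesis using assms by simp
next
  case False
  have "0 < B" using B[of x] r by (simp add: \<open>f x = 0\<close>)
  \<comment> \<open>Scaled to length \<open>r\<close>: the unit disc is mapped into the ball, and
    \<open>y\<close> has the parameter \<open>dist x y / r\<close>.\<close>
  define v where "v = complex_of_real (r / dist x y) *s (y - x)"
  define g where "g z = f (x + z *s v) / B" for z
  have "norm v = r"
    using False r unfolding v_def norm_vector_smult by (simp add: dist_norm norm_minus_commute norm_divide)
  then have mem: "x + z *s v \<in> cball x r" if "norm z < 1" for z
    using that r by (simp add: dist_norm norm_vector_smult)
  have "g holomorphic_on ball 0 1"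
    unfolding holomorphic_on_def
  proof
    fix z :: complex assume "z \<in> ball 0 1"
    then have "x + z *s v \<in> S" using mem S by auto
    from holo_on_line[OF f this] obtain d where "((\<lambda>z. f (x + z *s v)) has_field_derivative d) (at z)" by blast
    then have "(g has_field_derivative d / B) (at z)"
      unfolding g_def by (rule DERIV_cdivide)
    then show "g field_differentiable at z within ball 0 1"
      unfolding field_differentiable_def by (blast intro: has_field_derivative_at_within)
  qed
  moreover have "norm (g z) < 1" if "norm z < 1" for z
    using B[OF mem[OF that]] \<open>0 < B\<close> by (simp add: g_def norm_divide)
  moreover have "g 0 = 0"
    by (simp add: g_def \<open>f x = 0\<close>)
  ultimately have "norm (g z) \<le> norm z" if "norm z < 1" for z
    using Schwarz_Lemma(1)[of g z] that by blast
  moreover have "norm (complex_of_real (dist x y / r)) < 1"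
    using y r unfolding norm_of_real by simp
  ultimately have "norm (g (complex_of_real (dist x y / r))) \<le> norm (complex_of_real (dist x y / r))"
    by blast
  moreover have "x + complex_of_real (dist x y / r) *s v = y"
    using False r by (simp add: v_def vec_eq_iff)
  ultimately show ?thesis
    using \<open>0 < B\<close> r by (simp add: g_def norm_divide field_simps)
qed

lemma homeomorphism_chart:
  assumes "complex_manifold M"
  shows "homeomorphism (cdom M c) (chart M c ` cdom M c) (chart M c) (inv_chart M c)" and "open (cdom M c)"
  using assms by (auto simp: complex_manifold_def)

lemma inv_chart_chart:
  assumes "complex_manifold M" "p \<in> cdom M c"
  shows "inv_chart M c (chart M c p) = p"
  using homeomorphism_apply1[OF homeomorphism_chart(1)[OF assms(1)] assms(2)] .

lemma continuous_on_chart: "complex_manifold M \<Longrightarrow> continuous_on (cdom M c) (chart M c)"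
  using homeomorphism_cont1[OF homeomorphism_chart(1)] .

lemma continuous_on_in_charts:
  assumes M: "complex_manifold M" and "open V"
    and f: "\<And>c. continuous_on (chart M c ` (cdom M c \<inter> V)) (\<lambda>x. f (inv_chart M c x))"
  shows "continuous_on V f"
proof -
  have "continuous_on (cdom M c \<inter> V) f" for c
  proof -
    have "continuous_on (cdom M c \<inter> V) (\<lambda>p. f (inv_chart M c (chart M c p)))"
      by (intro continuous_on_compose2[OF f] continuous_on_subset[OF continuous_on_chart[OF M]]) auto
    then show ?thesis
      by (rule continuous_on_eq) (simp add: inv_chart_chart[OF M])
  qed
  then have "continuous_on (\<Union>c\<in>UNIV. cdom M c \<inter> V) f"
    using \<open>open V\<close> homeomorphism_chart(2)[OF M] by (intro continuous_on_open_UN) auto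
  moreover have "(\<Union>c\<in>UNIV. cdom M c \<inter> V) = V"
    using M by (auto simp: complex_manifold_def)
  ultimately show ?thesis by simp
qed

lemma smooth_fun_on_imp_continuous_on:
  assumes "complex_manifold M" "open V" "smooth_fun_on M V f"
  shows "continuous_on V f"
  using assms(1,2)
proof (rule continuous_on_in_charts)
  fix c
  have "Ck_on 0 (chart M c ` (cdom M c \<inter> V)) (\<lambda>x. f (inv_chart M c x))"
    using assms(3) unfolding smooth_fun_on_def smooth_on_def by blast
  then show "continuous_on (chart M c ` (cdom M c \<inter> V)) (\<lambda>x. f (inv_chart M c x))" by simp
qed

lemma holo_on_imp_continuous_on: "holo_on S f \<Longrightarrow> continuous_on S f"
  unfolding holo_on_def by (meson continuous_at_imp_continuous_on has_derivative_continuous)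

lemma holo_fun_on_imp_continuous_on:
  assumes "complex_manifold M" "open V" "holo_fun_on M V f"
  shows "continuous_on V f"
  using assms(1,2)
proof (rule continuous_on_in_charts)
  fix c
  show "continuous_on (chart M c ` (cdom M c \<inter> V)) (\<lambda>x. f (inv_chart M c x))"
    using assms(3) unfolding holo_fun_on_def by (intro holo_on_imp_continuous_on) blast
qed

lemma holo_on_lincomb:
  assumes "holo_on S f" "holo_on S g"
  shows "holo_on S (\<lambda>x. a * f x + b * g x)"
  unfolding holo_on_def
proof
  fix x assume "x \<in> S"
  then obtain D E where "(f has_derivative D) (at x)" "(g has_derivative E) (at x)"
    and D: "\<And>v. D (\<i> *s v) = \<i> * D v" "\<And>v. E (\<i> *s v) = \<i> * E v"
    using assms unfolding holo_on_def by metis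
  then have "((\<lambda>x. a * f x + b * g x) has_derivative (\<lambda>v. a * D v + b * E v)) (at x)"
    by (intro has_derivative_add has_derivative_mult_right)
  then show "\<exists>D. ((\<lambda>x. a * f x + b * g x) has_derivative D) (at x) \<and> (\<forall>v. D (\<i> *s v) = \<i> * D v)"
    by (intro exI[of _ "\<lambda>v. a * D v + b * E v"]) (simp add: D algebra_simps)
qed

lemma chart_ball:
  assumes M: "complex_manifold M" and "open V" "p \<in> V"
  obtains c r where "p \<in> cdom M c" "0 < r" "cball (chart M c p) r \<subseteq> chart M c ` (cdom M c \<inter> V)"
proof -
  obtain c where c: "p \<in> cdom M c"
    using M unfolding complex_manifold_def by blast
  have "open (chart M c ` (cdom M c \<inter> V))"
    by (rule open_chart_image[OF M \<open>open V\<close>])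
  moreover have "chart M c p \<in> chart M c ` (cdom M c \<inter> V)"
    using c \<open>p \<in> V\<close> by blast
  ultimately obtain r where "0 < r" "cball (chart M c p) r \<subseteq> chart M c ` (cdom M c \<inter> V)"
    by (meson open_contains_cball)
  with c show ?thesis by (rule that)
qed

definition chart_nbhd :: "('a, 'n::finite, 'c, 'z) atlas_scheme \<Rightarrow> 'c \<Rightarrow> 'a set \<Rightarrow> complex^'n \<Rightarrow> real \<Rightarrow> 'a set" where
  "chart_nbhd M c V x r = V \<inter> (cdom M c \<inter> chart M c -` ball x r)"

lemma open_chart_nbhd:
  assumes "complex_manifold M" "open V"
  shows "open (chart_nbhd M c V x r)"
  unfolding chart_nbhd_def
  by (intro open_Int assms continuous_open_preimage continuous_on_chart homeomorphism_chart open_ball)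

lemma chart_nbhd_subset: "chart_nbhd M c V x r \<subseteq> cdom M c" "chart_nbhd M c V x r \<subseteq> V"
  by (auto simp: chart_nbhd_def)

lemma chart_image_chart_nbhd:
  "ball x r \<subseteq> chart M c ` (cdom M c \<inter> V) \<Longrightarrow> chart M c ` chart_nbhd M c V x r = ball x r"
  by (auto simp: chart_nbhd_def)

lemma bounds_on_compact:
  fixes f :: "'b::topological_space \<Rightarrow> real"
  assumes "compact S" "S \<noteq> {}" "continuous_on S f" "\<And>x. x \<in> S \<Longrightarrow> 0 < f x"
  obtains a b where "0 < a" "a \<le> b" "\<And>x. x \<in> S \<Longrightarrow> a \<le> f x \<and> f x \<le> b"
proof -
  obtain x where x: "x \<in> S" "\<And>y. y \<in> S \<Longrightarrow> f x \<le> f y"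
    using continuous_attains_inf[OF assms(1-3)] by blast
  obtain z where z: "z \<in> S" "\<And>y. y \<in> S \<Longrightarrow> f y \<le> f z"
    using continuous_attains_sup[OF assms(1-3)] by blast
  show ?thesis
    using x z assms(4) by (intro that[of "f x" "f z"]) auto
qed

section \<open>Finiteness and full support of the Liouville measure\<close>

locale kaehler_manifold =
  fixes M :: "('a::t2_space, 'n::finite, 'c, 'z) kaehler_data_scheme"
  assumes compact: "compact (UNIV :: 'a set)"
    and manifold: "complex_manifold M"
    and kaehler: "kaehler_form M"
    and liouville: "liouville_volume M"
begin

lemma sets_vol: "sets (vol M) = sets borel"
  using liouville by (simp add: liouville_volume_def)

lemma space_vol: "space (vol M) = UNIV"
  using sets_eq_imp_space_eq[OF sets_vol] by simp

text \<open>The Liouville density is continuous and positive, and the closed ball is compact. The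
  upper bound makes the measure finite, the lower one makes it positive on open sets.\<close>

lemma omega_power_bounds:
  assumes "0 < r" "cball x r \<subseteq> chart M c ` cdom M c"
  obtains a b where "0 < a" "a \<le> b"
    "\<And>y. y \<in> cball x r \<Longrightarrow> a \<le> omega_power M c (inv_chart M c y) / fact CARD('n)
        \<and> omega_power M c (inv_chart M c y) / fact CARD('n) \<le> b"
proof -
  have "continuous_on (chart M c ` cdom M c) (\<lambda>y. omega M c (inv_chart M c y) v u)" for v u
  proof -
    have "smooth_fun_on M (cdom M c) (\<lambda>p. omega M c p v u)"
      using kaehler[unfolded kaehler_form_def, THEN conjunct2, THEN conjunct2, THEN conjunct1] by blast
    then have "Ck_on 0 (chart M c ` (cdom M c \<inter> cdom M c)) (\<lambda>y. omega M c (inv_chart M c y) v u)"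
      unfolding smooth_fun_on_def smooth_on_def by blast
    then show ?thesis by simp
  qed
  then have cont: "continuous_on (cball x r) (\<lambda>y. omega_power M c (inv_chart M c y) / fact CARD('n))"
    unfolding omega_power_def using continuous_on_subset[OF _ assms(2)]
    by (intro continuous_intros) auto
  have pos: "0 < omega_power M c (inv_chart M c y) / fact CARD('n)" if "y \<in> cball x r" for y
  proof -
    obtain p where "p \<in> cdom M c" "y = chart M c p" using \<open>y \<in> cball x r\<close> assms(2) by blast
    then show ?thesis
      using omega_power_pos[OF kaehler] inv_chart_chart[OF manifold] by simp
  qed
  have ne: "cball x r \<noteq> {}" using \<open>0 < r\<close> by simp
  show ?thesis
    by (rule bounds_on_compact[OF compact_cball ne cont pos]) (assumption, rule that)
qed

lemma emeasure_vol_chart_nbhd: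
  assumes "open V" "ball x r \<subseteq> chart M c ` (cdom M c \<inter> V)"
  shows "emeasure (vol M) (chart_nbhd M c V x r)
    = (\<integral>\<^sup>+ y \<in> ball x r. ennreal (omega_power M c (inv_chart M c y) / fact CARD('n)) \<partial>lborel)"
proof -
  have "chart_nbhd M c V x r \<in> sets borel"
    by (intro borel_open open_chart_nbhd manifold assms)
  from liouville[unfolded liouville_volume_def, THEN conjunct2, rule_format, OF this chart_nbhd_subset(1)]
  show ?thesis by (simp only: chart_image_chart_nbhd[OF assms(2)])
qed

lemma emeasure_vol_finite: "emeasure (vol M) UNIV < \<infinity>"
proof -
  have "\<exists>U. open U \<and> p \<in> U \<and> emeasure (vol M) U < \<infinity>" for p
  proof -
    obtain c r where c: "p \<in> cdom M c" "0 < r" "cball (chart M c p) r \<subseteq> chart M c ` (cdom M c \<inter> UNIV)"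
      using chart_ball[OF manifold open_UNIV UNIV_I] by metis
    let ?x = "chart M c p"
    let ?U = "chart_nbhd M c UNIV ?x r"
    obtain a b where "0 < a" "a \<le> b" and ab: "\<And>y. y \<in> cball ?x r \<Longrightarrow> a \<le> omega_power M c (inv_chart M c y) / fact CARD('n)
        \<and> omega_power M c (inv_chart M c y) / fact CARD('n) \<le> b"
      using omega_power_bounds[OF c(2)] c(3) by (metis inf_top_right)
    have ball: "ball ?x r \<subseteq> chart M c ` (cdom M c \<inter> UNIV)"
      using c(3) ball_subset_cball by blast
    have "emeasure (vol M) ?U \<le> (\<integral>\<^sup>+ y. ennreal b * indicator (ball ?x r) y \<partial>lborel)"
      unfolding emeasure_vol_chart_nbhd[OF open_UNIV ball] using ab
      by (intro nn_integral_mono) (auto simp: indicator_def intro!: ennreal_leI)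
    also have "\<dots> = ennreal b * emeasure lborel (ball ?x r)"
      by (subst nn_integral_cmult_indicator) auto
    also have "\<dots> < \<infinity>"
      using emeasure_lborel_ball_finite[of ?x r] by (simp add: ennreal_mult_less_top)
    finally show ?thesis
      using open_chart_nbhd[OF manifold open_UNIV] c by (intro exI[of _ ?U]) (auto simp: chart_nbhd_def)
  qed
  then obtain U where U: "\<And>p. open (U p)" "\<And>p. p \<in> U p" "\<And>p. emeasure (vol M) (U p) < \<infinity>"
    by metis
  have "UNIV \<subseteq> (\<Union>p\<in>UNIV. U p)"
    using U(2) by auto
  from compactE_image[OF compact U(1) this]
  obtain A where A: "finite A" "UNIV \<subseteq> (\<Union>p\<in>A. U p)" .
  have S: "U p \<in> sets (vol M)" for p
    using U(1) by (simp add: sets_vol)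
  then have "emeasure (vol M) UNIV \<le> emeasure (vol M) (\<Union>p\<in>A. U p)"
    using A(1) by (intro emeasure_mono A) auto
  also have "\<dots> \<le> (\<Sum>p\<in>A. emeasure (vol M) (U p))"
    using A(1) S by (intro emeasure_subadditive_finite) auto
  also have "\<dots> < \<infinity>"
    using A(1) U(3) by (simp add: less_top[symmetric])
  finally show ?thesis .
qed

lemma emeasure_vol_open_pos:
  assumes "open V" "p \<in> V"
  shows "0 < emeasure (vol M) V"
proof -
  obtain c r where c: "p \<in> cdom M c" "0 < r" "cball (chart M c p) r \<subseteq> chart M c ` (cdom M c \<inter> V)"
    using chart_ball[OF manifold assms] by metis
  let ?x = "chart M c p"
  from c(3) have "cball ?x r \<subseteq> chart M c ` cdom M c" by blast
  from omega_power_bounds[OF c(2) this]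
  obtain a b where "0 < a" "a \<le> b" and ab: "\<And>y. y \<in> cball ?x r \<Longrightarrow> a \<le> omega_power M c (inv_chart M c y) / fact CARD('n)
      \<and> omega_power M c (inv_chart M c y) / fact CARD('n) \<le> b" by blast
  have ball: "ball ?x r \<subseteq> chart M c ` (cdom M c \<inter> V)"
    using c(3) ball_subset_cball by blast
  have "0 < ennreal a * emeasure lborel (ball ?x r)"
    using \<open>0 < a\<close> content_ball_pos[OF c(2), of ?x]
    by (simp add: ennreal_zero_less_mult_iff measure_def enn2real_positive_iff)
  also have "\<dots> = (\<integral>\<^sup>+ y. ennreal a * indicator (ball ?x r) y \<partial>lborel)"
    by (subst nn_integral_cmult_indicator) auto
  also have "\<dots> \<le> emeasure (vol M) (chart_nbhd M c V ?x r)"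
    unfolding emeasure_vol_chart_nbhd[OF assms(1) ball] using ab
    by (intro nn_integral_mono) (auto simp: indicator_def intro!: ennreal_leI)
  also have "\<dots> \<le> emeasure (vol M) V"
    using assms(1) by (intro emeasure_mono) (auto simp: chart_nbhd_def sets_vol)
  finally show ?thesis .
qed

sublocale vol: finite_measure "vol M"
  using emeasure_vol_finite by (intro finite_measureI) (simp add: space_vol less_top[symmetric])

lemma integrable_vol_continuous:
  fixes f :: "'a \<Rightarrow> 'b::{banach, second_countable_topology}"
  assumes "continuous_on UNIV f"
  shows "integrable (vol M) f"
proof -
  have "compact (range f)"
    using compact_continuous_image[OF assms compact] .
  then obtain B where "\<And>p. norm (f p) \<le> B"
    using bounded_iff compact_imp_bounded by (metis rangeI)
  moreover have "f \<in> borel_measurable (vol M)"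
    using borel_measurable_continuous_onI[OF assms] by (simp add: measurable_cong_sets[OF sets_vol refl])
  ultimately show ?thesis
    by (intro vol.integrable_const_bound) auto
qed

text \<open>Full support turns "almost everywhere zero" into "zero" for continuous functions; the
  scalar product of sections is definite for this reason.\<close>

lemma integral_vol_eq_0:
  fixes f :: "'a \<Rightarrow> real"
  assumes "continuous_on UNIV f" "\<And>p. 0 \<le> f p" "(LINT p|vol M. f p) = 0"
  shows "f p = 0"
proof (rule ccontr)
  assume "f p \<noteq> 0"
  have "open (f -` (- {0}))"
    using open_vimage[of "- {0::real}" f] assms(1) by auto
  then have "0 < emeasure (vol M) (f -` (- {0}))"
    using \<open>f p \<noteq> 0\<close> by (intro emeasure_vol_open_pos[of _ p]) auto
  moreover have "AE q in vol M. f q = 0"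
    using integral_nonneg_eq_0_iff_AE[OF integrable_vol_continuous[OF assms(1)]] assms(2,3) by simp
  then have "emeasure (vol M) {q \<in> space (vol M). f q \<noteq> 0} = 0"
    using borel_measurable_integrable[OF integrable_vol_continuous[OF assms(1)]]
    by (subst AE_iff_measurable[symmetric, where P = "\<lambda>q. f q = 0"]) auto
  moreover have "{q \<in> space (vol M). f q \<noteq> 0} = f -` (- {0})"
    by (auto simp: space_vol)
  ultimately show False by simp
qed

end

section \<open>Holomorphic sections and orthogonal projections\<close>

text \<open>
  The Gram-Schmidt process along point evaluations, so that finite dimension enters only through
  the injectivity of finitely many evaluations.
\<close>
lemma riesz_representation_of_evaluations:
  fixes W V :: "('i \<Rightarrow> 'a \<Rightarrow> complex) set"
    and B :: "('i \<Rightarrow> 'a \<Rightarrow> complex) \<Rightarrow> ('i \<Rightarrow> 'a \<Rightarrow> complex) \<Rightarrow> complex"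
    and \<phi> :: "('i \<Rightarrow> 'a \<Rightarrow> complex) \<Rightarrow> complex"
  assumes B: "\<And>r s t a b. r \<in> W \<Longrightarrow> s \<in> W \<Longrightarrow> t \<in> W \<Longrightarrow>
        B r (\<lambda>i p. a * s i p + b * t i p) = a * B r s + b * B r t"
      "\<And>r s t a b. r \<in> W \<Longrightarrow> s \<in> W \<Longrightarrow> t \<in> W \<Longrightarrow>
        B (\<lambda>i p. a * s i p + b * t i p) r = cnj a * B s r + cnj b * B t r"
      "\<And>s. s \<in> W \<Longrightarrow> B s s = 0 \<Longrightarrow> s = (\<lambda>i p. 0)"
    and \<phi>: "\<forall>s\<in>W. \<forall>t\<in>W. \<forall>a b. \<phi> (\<lambda>i p. a * s i p + b * t i p) = cnj a * \<phi> s + cnj b * \<phi> t"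
    and V: "V \<subseteq> W" "(\<lambda>i p. 0) \<in> V" "\<forall>s\<in>V. \<forall>t\<in>V. \<forall>a b. (\<lambda>i p. a * s i p + b * t i p) \<in> V"
    and E: "\<forall>s\<in>V. (\<forall>(i, p) \<in> set E. s i p = 0) \<longrightarrow> s = (\<lambda>i p. 0)"
  shows "\<exists>t\<in>V. \<forall>r\<in>V. B r t = \<phi> r"
  using \<phi> V E
proof (induction E arbitrary: V \<phi>)
  case Nil
  let ?z = "\<lambda>(i::'i) (p::'a). 0 :: complex"
  have z: "?z \<in> W" using Nil.prems(2,3) by blast
  have "B ?z ?z = 0"
    using B(1)[OF z z z, of 0 0] by simp
  moreover have "\<phi> ?z = 0"
    using Nil.prems(1)[rule_format, OF z z, of 0 0] by simp
  moreover have V0: "V \<subseteq> {?z}"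
    using Nil.prems(5) unfolding list.set by blast
  ultimately have "\<forall>r\<in>{?z}. B r ?z = \<phi> r" by simp
  then have "\<forall>r\<in>V. B r ?z = \<phi> r" by (rule bspec[THEN ballI, OF _ subsetD[OF V0]])
  then show ?case using Nil.prems(3) by (rule bexI)
next
  case (Cons x E)
  note VW = subsetD[OF Cons.prems(2)]
  obtain i p where x: "x = (i, p)" by (cases x)
  define V' where "V' = {s \<in> V. s i p = 0}"
  have V': "V' \<subseteq> V" by (auto simp: V'_def)
  have IH: "\<exists>t\<in>V'. \<forall>r\<in>V'. B r t = \<psi> r"
    if "\<forall>s\<in>W. \<forall>t\<in>W. \<forall>a b. \<psi> (\<lambda>i p. a * s i p + b * t i p) = cnj a * \<psi> s + cnj b * \<psi> t" for \<psi>
    using that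
  proof (rule Cons.IH)
    show "\<forall>s\<in>V'. (\<forall>(i, p)\<in>set E. s i p = 0) \<longrightarrow> s = (\<lambda>i p. 0)"
      using Cons.prems(5) by (auto simp: V'_def x)
  qed (use Cons.prems(2-4) in \<open>auto simp: V'_def\<close>)
  obtain t' where t': "t' \<in> V'" "\<And>r. r \<in> V' \<Longrightarrow> B r t' = \<phi> r"
    using IH[OF Cons.prems(1)] by blast
  show ?case
  proof (cases "V' = V")
    case True
    then show ?thesis using t' by blast
  next
    case False
    then obtain w0 where w0: "w0 \<in> V" "w0 i p \<noteq> 0" by (auto simp: V'_def)
    \<comment> \<open>The functional in the induction hypothesis is arbitrary for this purpose:
      representing pairing with \<open>w0\<close> on \<open>V'\<close> gives the projection
      \<open>w1\<close> of \<open>w0\<close>, and \<open>w0 - w1\<close> is orthogonal to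
      \<open>V'\<close>.\<close>
    have "\<forall>s\<in>W. \<forall>t\<in>W. \<forall>a b. B (\<lambda>i p. a * s i p + b * t i p) w0 = cnj a * B s w0 + cnj b * B t w0"
      using B(2)[OF VW[OF w0(1)]] by blast
    from IH[OF this] obtain w1 where w1: "w1 \<in> V'" "\<And>r. r \<in> V' \<Longrightarrow> B r w1 = B r w0"
      by blast
    define w where "w = (\<lambda>i p. 1 * w0 i p + (-1) * w1 i p)"
    have w: "w \<in> V" unfolding w_def using w0 w1 V' by (intro Cons.prems(4)[rule_format]) auto
    have wp: "w i p \<noteq> 0" using w0 w1 by (simp add: w_def V'_def)
    have orth: "B r w = 0" if "r \<in> V'" for r
      unfolding w_def using that w0 w1 V' VW by (subst B(1)) auto
    have "B w w \<noteq> 0"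
      using B(3)[OF VW[OF w]] wp by auto
    \<comment> \<open>\<open>t'\<close> is right on \<open>V'\<close>, where adding multiples of
      \<open>w\<close> changes nothing; \<open>c\<close> is solved from
      \<open>B w t = \<phi> w\<close>.\<close>
    define c where "c = (\<phi> w - B w t') / B w w"
    define t where "t = (\<lambda>i p. 1 * t' i p + c * w i p)"
    have t: "t \<in> V" unfolding t_def using t' w V' by (intro Cons.prems(4)[rule_format]) auto
    have "B r t = \<phi> r" if "r \<in> V" for r
    proof -
      define d where "d = r i p / w i p"
      define r' where "r' = (\<lambda>i p. 1 * r i p + (-d) * w i p)"
      have r': "r' \<in> V" unfolding r'_def using that w by (intro Cons.prems(4)[rule_format])
      then have r'V: "r' \<in> V'" using wp by (simp add: V'_def r'_def d_def)
      have r: "r = (\<lambda>i p. 1 * r' i p + d * w i p)" by (simp add: r'_def fun_eq_iff)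
      have Bt: "B v t = B v t' + c * B v w" if "v \<in> V" for v
        unfolding t_def using that t' w V' VW by (subst B(1)) auto
      have "B r t = B r' t + cnj d * B w t"
        using B(2)[OF VW[OF t] VW[OF r'] VW[OF w], of 1 d] r by simp
      also have "B r' t = \<phi> r'"
        using Bt[OF r'] t'(2)[OF r'V] orth[OF r'V] by simp
      also have "B w t = \<phi> w"
        using Bt[OF w] \<open>B w w \<noteq> 0\<close> by (simp add: c_def)
      also have "\<phi> r' + cnj d * \<phi> w = \<phi> r"
        using Cons.prems(1)[rule_format, OF VW[OF r'] VW[OF w], of 1 d] r by simp
      finally show ?thesis .
    qed
    with t show ?thesis by blast
  qed
qed

section \<open>Continuous sections and their scalar product\<close>

locale quantized_manifold = kaehler_manifold Q
  for Q :: "('a::t2_space, 'n::finite, 'c, 'i) quantum_data" +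
  assumes line_bundle: "quantum_line_bundle Q"
begin

lemma shows tdom_cover: "\<exists>i. p \<in> tdom Q i" and open_tdom: "open (tdom Q i)"
  and herm_smooth: "smooth_fun_on Q (tdom Q i) (herm Q i)"
  and herm_pos: "p \<in> tdom Q i \<Longrightarrow> 0 < herm Q i p"
  and herm_change: "p \<in> tdom Q i \<Longrightarrow> p \<in> tdom Q j \<Longrightarrow> herm Q j p = (cmod (cocycle Q i j p))\<^sup>2 * herm Q i p"
proof -
  note b = line_bundle[unfolded quantum_line_bundle_def]
  note l = b[THEN conjunct1, unfolded holomorphic_line_bundle_def]
  note h = b[THEN conjunct2, THEN conjunct1, unfolded hermitian_metric_def]
  show "\<exists>i. p \<in> tdom Q i" using l[THEN conjunct1] by blast
  show "open (tdom Q i)" using l[THEN conjunct2, THEN conjunct1] by blast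
  show "smooth_fun_on Q (tdom Q i) (herm Q i)" using h[THEN conjunct1] by blast
  show "p \<in> tdom Q i \<Longrightarrow> 0 < herm Q i p" using h[THEN conjunct1] by blast
  show "p \<in> tdom Q i \<Longrightarrow> p \<in> tdom Q j \<Longrightarrow> herm Q j p = (cmod (cocycle Q i j p))\<^sup>2 * herm Q i p"
    using h[THEN conjunct2] by blast
qed

text \<open>Stands in for square-integrable sections: it contains all products of a continuous
  function and a holomorphic section, and by compactness all scalar products converge.\<close>

definition continuous_sections :: "nat \<Rightarrow> ('i \<Rightarrow> 'a \<Rightarrow> complex) set" where
  "continuous_sections m = {s \<in> power_sections Q m. \<forall>i. continuous_on (tdom Q i) (s i)}"

lemma holo_sections_continuous: "s \<in> holo_sections Q m \<Longrightarrow> s \<in> continuous_sections m"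
  by (auto simp: holo_sections_def continuous_sections_def
      intro: holo_fun_on_imp_continuous_on[OF manifold open_tdom])

lemma power_sections_lincomb:
  assumes "s \<in> power_sections Q m" "t \<in> power_sections Q m"
  shows "(\<lambda>i p. f p * s i p + g p * t i p) \<in> power_sections Q m"
  unfolding power_sections_def
proof (intro CollectI conjI allI ballI impI)
  fix i j p assume "p \<in> tdom Q i \<inter> tdom Q j"
  then have "s i p = cocycle Q i j p ^ m * s j p" "t i p = cocycle Q i j p ^ m * t j p"
    using assms unfolding power_sections_def by blast+
  then show "f p * s i p + g p * t i p = cocycle Q i j p ^ m * (f p * s j p + g p * t j p)"
    by (simp add: algebra_simps)
next
  fix i p assume "p \<notin> tdom Q i"
  then show "f p * s i p + g p * t i p = 0"
    using assms unfolding power_sections_def by simp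
qed

lemma holo_sections_lincomb:
  assumes "s \<in> holo_sections Q m" "t \<in> holo_sections Q m"
  shows "(\<lambda>i p. a * s i p + b * t i p) \<in> holo_sections Q m"
  using assms by (auto simp: holo_sections_def holo_fun_on_def power_sections_lincomb intro!: holo_on_lincomb)

lemma zero_holo_section: "(\<lambda>i p. 0) \<in> holo_sections Q m"
  by (auto simp: holo_sections_def power_sections_def holo_fun_on_def holo_on_def intro!: exI[of _ "\<lambda>_. 0"])

lemma continuous_sections_lincomb:
  assumes "s \<in> continuous_sections m" "t \<in> continuous_sections m"
    and "continuous_on UNIV f" "continuous_on UNIV g"
  shows "(\<lambda>i p. f p * s i p + g p * t i p) \<in> continuous_sections m"
  using assms power_sections_lincomb
  by (auto simp: continuous_sections_def intro!: continuous_intros intro: continuous_on_subset)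

lemma continuous_sections_scale:
  "s \<in> continuous_sections m \<Longrightarrow> continuous_on UNIV f \<Longrightarrow> (\<lambda>i p. f p * s i p) \<in> continuous_sections m"
  using continuous_sections_lincomb[of s m s f "\<lambda>_. 0"] by simp

lemma continuous_sections_diff:
  "s \<in> continuous_sections m \<Longrightarrow> t \<in> continuous_sections m \<Longrightarrow> (\<lambda>i p. s i p - t i p) \<in> continuous_sections m"
  using continuous_sections_lincomb[of s m t "\<lambda>_. 1" "\<lambda>_. -1"] by simp

text \<open>\<open>hprod\<close> picks a frame at each point separately, so continuity is visible
  only in a fixed frame. The m-th powers of the transition factor in both sections are absorbed by
  the change of \<open>herm\<close>.\<close>

lemma hprod_eq:
  assumes "s \<in> continuous_sections m" "t \<in> continuous_sections m" "p \<in> tdom Q i"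
  shows "hprod Q m s t p = cnj (s i p) * t i p * of_real (herm Q i p ^ m)"
proof -
  define j where "j = triv_at Q p"
  have j: "p \<in> tdom Q j"
    unfolding j_def triv_at_def using someI_ex[OF tdom_cover] .
  define g where "g = cocycle Q i j p"
  have "s i p = g ^ m * s j p" "t i p = g ^ m * t j p"
    using assms j unfolding continuous_sections_def power_sections_def g_def by blast+
  moreover have "complex_of_real (herm Q j p) = g * cnj g * of_real (herm Q i p)"
    using herm_change[OF assms(3) j] by (simp add: g_def complex_norm_square[symmetric])
  ultimately show ?thesis
    by (simp add: hprod_def Let_def j_def[symmetric] power_mult_distrib)
qed

lemma continuous_hprod:
  assumes "s \<in> continuous_sections m" "t \<in> continuous_sections m"
  shows "continuous_on UNIV (hprod Q m s t)"
proof -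
  have "continuous_on (tdom Q i) (hprod Q m s t)" for i
  proof -
    have "continuous_on (tdom Q i) (s i)" "continuous_on (tdom Q i) (t i)"
      using assms by (auto simp: continuous_sections_def)
    then have "continuous_on (tdom Q i) (\<lambda>p. cnj (s i p) * t i p * of_real (herm Q i p ^ m))"
      by (intro continuous_intros smooth_fun_on_imp_continuous_on[OF manifold open_tdom herm_smooth])
    then show ?thesis
      by (rule continuous_on_eq) (simp add: hprod_eq[OF assms])
  qed
  then have "continuous_on (\<Union>i\<in>UNIV. tdom Q i) (hprod Q m s t)"
    by (intro continuous_on_open_UN open_tdom)
  moreover have "(\<Union>i\<in>UNIV. tdom Q i) = UNIV" using tdom_cover by auto
  ultimately show ?thesis by simp
qed

lemma integrable_hprod:
  "s \<in> continuous_sections m \<Longrightarrow> t \<in> continuous_sections m \<Longrightarrow> integrable (vol Q) (hprod Q m s t)"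
  by (intro integrable_vol_continuous continuous_hprod)

lemma scalar_product_cnj: "scalar_product Q m t s = cnj (scalar_product Q m s t)"
proof -
  have "hprod Q m t s p = cnj (hprod Q m s t p)" for p
    by (simp add: hprod_def Let_def mult.commute)
  then show ?thesis by (simp add: scalar_product_def)
qed

lemma scalar_product_lincomb_right:
  assumes "r \<in> continuous_sections m" "s \<in> continuous_sections m" "t \<in> continuous_sections m"
  shows "scalar_product Q m r (\<lambda>i p. a * s i p + b * t i p) = a * scalar_product Q m r s + b * scalar_product Q m r t"
proof -
  have "hprod Q m r (\<lambda>i p. a * s i p + b * t i p) p = a * hprod Q m r s p + b * hprod Q m r t p" for p
    by (simp add: hprod_def Let_def algebra_simps)
  then show ?thesis
    by (simp add: scalar_product_def integrable_hprod assms)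
qed

lemma scalar_product_lincomb_left:
  assumes "r \<in> continuous_sections m" "s \<in> continuous_sections m" "t \<in> continuous_sections m"
  shows "scalar_product Q m (\<lambda>i p. a * s i p + b * t i p) r = cnj a * scalar_product Q m s r + cnj b * scalar_product Q m t r"
  using scalar_product_lincomb_right[OF assms, of a b] scalar_product_cnj[of m _ r] by simp

definition sqnorm_at :: "nat \<Rightarrow> ('i \<Rightarrow> 'a \<Rightarrow> complex) \<Rightarrow> 'a \<Rightarrow> real" where
  "sqnorm_at m s p = Re (hprod Q m s s p)"

text \<open>Estimates stay quadratic; square roots enter only in the comparison with
  \<open>op_norm\<close>.\<close>

definition sqnorm :: "nat \<Rightarrow> ('i \<Rightarrow> 'a \<Rightarrow> complex) \<Rightarrow> real" where
  "sqnorm m s = Re (scalar_product Q m s s)"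

lemma sqnorm_at_eq:
  assumes "s \<in> continuous_sections m" "p \<in> tdom Q i"
  shows "sqnorm_at m s p = (cmod (s i p))\<^sup>2 * herm Q i p ^ m"
proof -
  have "cnj (s i p) * s i p = of_real ((cmod (s i p))\<^sup>2)"
    by (simp add: complex_norm_square[symmetric] mult.commute)
  then show ?thesis
    unfolding sqnorm_at_def hprod_eq[OF assms(1,1,2)] by simp
qed

lemma sqnorm_at_nonneg: "s \<in> continuous_sections m \<Longrightarrow> 0 \<le> sqnorm_at m s p"
  using tdom_cover[of p] by (metis sqnorm_at_eq herm_pos less_imp_le mult_nonneg_nonneg zero_le_power zero_le_power2)

lemma continuous_sqnorm_at: "s \<in> continuous_sections m \<Longrightarrow> continuous_on UNIV (sqnorm_at m s)"
  unfolding sqnorm_at_def by (intro continuous_intros continuous_hprod)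

lemma sqnorm_eq_integral: "s \<in> continuous_sections m \<Longrightarrow> sqnorm m s = (LINT p|vol Q. sqnorm_at m s p)"
  unfolding sqnorm_def scalar_product_def sqnorm_at_def by (simp add: integrable_hprod)

lemma sqnorm_nonneg: "s \<in> continuous_sections m \<Longrightarrow> 0 \<le> sqnorm m s"
  by (simp add: sqnorm_eq_integral sqnorm_at_nonneg)

lemma sqnorm_at_eq_0_imp:
  assumes s: "s \<in> continuous_sections m" and "\<And>p. sqnorm_at m s p = 0"
  shows "s = (\<lambda>i p. 0)"
proof (intro ext)
  fix i p
  show "s i p = 0"
  proof (cases "p \<in> tdom Q i")
    case True
    then show ?thesis
      using assms(2)[of p] sqnorm_at_eq[OF s True] herm_pos[OF True] by simp
  next
    case False
    then show ?thesis using s by (simp add: continuous_sections_def power_sections_def)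
  qed
qed

lemma sqnorm_eq_0_imp:
  assumes "s \<in> continuous_sections m" "sqnorm m s = 0"
  shows "s = (\<lambda>i p. 0)"
  using assms integral_vol_eq_0[OF continuous_sqnorm_at[OF assms(1)] sqnorm_at_nonneg[OF assms(1)]]
  by (intro sqnorm_at_eq_0_imp) (simp_all add: sqnorm_eq_integral)

lemma sqnorm_scale: "sqnorm m (\<lambda>i p. a * s i p) = (cmod a)\<^sup>2 * sqnorm m s"
proof -
  have "hprod Q m (\<lambda>i p. a * s i p) (\<lambda>i p. a * s i p) = (\<lambda>p. of_real ((cmod a)\<^sup>2) * hprod Q m s s p)"
    by (simp only: complex_norm_square) (simp add: hprod_def Let_def fun_eq_iff mult.commute mult.left_commute)
  then show ?thesis
    by (simp add: sqnorm_def scalar_product_def)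
qed

lemma sqnorm_zero: "sqnorm m (\<lambda>i p. 0) = 0"
  using sqnorm_scale[of m 0 "\<lambda>i p. 0"] by simp

lemma sqnorm_lincomb_eq:
  assumes "s \<in> continuous_sections m" "t \<in> continuous_sections m"
  shows "sqnorm m (\<lambda>i p. a * s i p + b * t i p)
    = (cmod a)\<^sup>2 * sqnorm m s + (cmod b)\<^sup>2 * sqnorm m t + 2 * Re (cnj a * b * scalar_product Q m s t)"
proof -
  have st: "(\<lambda>i p. a * s i p + b * t i p) \<in> continuous_sections m"
    using assms by (intro continuous_sections_lincomb) auto
  have "scalar_product Q m s s = of_real (sqnorm m s)" "scalar_product Q m t t = of_real (sqnorm m t)"
    using scalar_product_cnj[of m s s] scalar_product_cnj[of m t t]
    by (auto simp: sqnorm_def complex_eq_iff)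
  then have "scalar_product Q m (\<lambda>i p. a * s i p + b * t i p) (\<lambda>i p. a * s i p + b * t i p)
    = cnj a * a * of_real (sqnorm m s) + cnj b * b * of_real (sqnorm m t)
      + (cnj a * b * scalar_product Q m s t + cnj (cnj a * b * scalar_product Q m s t))"
    using assms st by (simp add: scalar_product_lincomb_left scalar_product_lincomb_right
        scalar_product_cnj[of m t s] algebra_simps)
  also have "cnj a * a = of_real ((cmod a)\<^sup>2)"
    by (simp only: complex_norm_square mult.commute)
  also have "cnj b * b = of_real ((cmod b)\<^sup>2)"
    by (simp only: complex_norm_square mult.commute)
  finally show ?thesis unfolding sqnorm_def[of m "\<lambda>i p. _ i p"] by (simp add: algebra_simps)
qed

text \<open>Parallelogram law with the square for \<open>- b\<close> dropped. At the cost of a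
  factor 2 it serves as a triangle inequality for squared norms.\<close>

lemma sqnorm_lincomb:
  assumes "s \<in> continuous_sections m" "t \<in> continuous_sections m"
  shows "sqnorm m (\<lambda>i p. a * s i p + b * t i p) \<le> 2 * (cmod a)\<^sup>2 * sqnorm m s + 2 * (cmod b)\<^sup>2 * sqnorm m t"
proof -
  have "(\<lambda>i p. a * s i p + (- b) * t i p) \<in> continuous_sections m"
    using assms by (intro continuous_sections_lincomb) auto
  then have "0 \<le> sqnorm m (\<lambda>i p. a * s i p + (- b) * t i p)"
    by (rule sqnorm_nonneg)
  then show ?thesis
    unfolding sqnorm_lincomb_eq[OF assms] by (simp add: algebra_simps)
qed

lemma sqnorm_at_bounded:
  assumes "s \<in> continuous_sections m"
  shows "\<exists>q. \<forall>p. sqnorm_at m s p \<le> sqnorm_at m s q"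
  using continuous_attains_sup[OF compact _ continuous_sqnorm_at[OF assms]] by auto

section \<open>Separation of holomorphic sections by finitely many points\<close>

lemma local_decay:
  "\<exists>i U. open U \<and> p \<in> U \<and> (\<forall>s\<in>holo_sections Q m. s i p = 0 \<longrightarrow>
     (\<forall>K>0. (\<forall>q. sqnorm_at m s q \<le> K) \<longrightarrow> (\<forall>q\<in>U. sqnorm_at m s q \<le> K / 2)))"
proof -
  obtain i where i: "p \<in> tdom Q i" using tdom_cover by blast
  obtain c r where c: "p \<in> cdom Q c" and r: "0 < r"
    and cb: "cball (chart Q c p) r \<subseteq> chart Q c ` (cdom Q c \<inter> tdom Q i)"
    using chart_ball[OF manifold open_tdom i] by blast
  define x where "x = chart Q c p"
  define h where "h y = herm Q i (inv_chart Q c y) ^ m" for y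
  have inv: "inv_chart Q c (chart Q c q) = q" if "q \<in> cdom Q c" for q
    using inv_chart_chart[OF manifold that] .
  have mem: "inv_chart Q c y \<in> tdom Q i \<and> inv_chart Q c y \<in> cdom Q c" if "y \<in> cball x r" for y
    using that cb inv unfolding x_def by force
  have "Ck_on 0 (chart Q c ` (cdom Q c \<inter> tdom Q i)) (\<lambda>y. herm Q i (inv_chart Q c y))"
    using herm_smooth unfolding smooth_fun_on_def smooth_on_def by blast
  then have "continuous_on (cball x r) (\<lambda>y. herm Q i (inv_chart Q c y))"
    using cb by (auto simp: x_def intro: continuous_on_subset)
  then have cont: "continuous_on (cball x r) h"
    unfolding h_def by (intro continuous_intros)
  have pos: "0 < h y" if "y \<in> cball x r" for y
    unfolding h_def using herm_pos mem[OF that] by simp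
  have ne: "cball x r \<noteq> {}" using r by simp
  obtain a b where ab: "0 < a" "a \<le> b" "\<And>y. y \<in> cball x r \<Longrightarrow> a \<le> h y \<and> h y \<le> b"
    using bounds_on_compact[OF compact_cball ne cont pos] by blast
  \<comment> \<open>With squared supremum \<open>4 * (K / a)\<close> in the Schwarz lemma and
    \<open>h \<le> b\<close>, the value K / 2 is reached when the squared ratio of the distance to
    \<open>r\<close> is \<open>a / (8 * b)\<close>. The radius depends neither on the section nor on
    \<open>K\<close>, which allows a finite subcover for all sections at once.\<close>
  define \<delta> where "\<delta> = min r (r * sqrt (a / (8 * b)))"
  have \<delta>: "0 < \<delta>" using r ab by (simp add: \<delta>_def)
  define U where "U = chart_nbhd Q c (tdom Q i) x \<delta>"
  have "sqnorm_at m s q \<le> K / 2"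
    if s: "s \<in> holo_sections Q m" "s i p = 0" and K: "0 < K" "\<And>q. sqnorm_at m s q \<le> K" and q: "q \<in> U" for s K q
  proof -
    note sc = holo_sections_continuous[OF s(1)]
    let ?f = "\<lambda>y. s i (inv_chart Q c y)"
    define y where "y = chart Q c q"
    have qd: "q \<in> tdom Q i" "q \<in> cdom Q c" and y: "y \<in> ball x \<delta>"
      using q by (auto simp: U_def chart_nbhd_def y_def)
    have "y \<in> ball x r" using y by (simp add: \<delta>_def)
    \<comment> \<open>The factor 2 makes the bound strict.\<close>
    define B where "B = 2 * sqrt (K / a)"
    have bd: "cmod (?f z) < B" if "z \<in> cball x r" for z
    proof -
      have "(cmod (?f z))\<^sup>2 * a \<le> (cmod (?f z))\<^sup>2 * h z"
        using ab(3)[OF that] by (intro mult_left_mono) auto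
      also have "\<dots> \<le> K"
        using K(2)[of "inv_chart Q c z"] sqnorm_at_eq[OF sc, of "inv_chart Q c z" i] mem[OF that] by (simp add: h_def)
      finally have "(cmod (?f z))\<^sup>2 \<le> K / a"
        using ab(1) by (simp add: field_simps)
      then have "cmod (?f z) \<le> sqrt (K / a)"
        by (rule real_le_rsqrt)
      moreover have "0 < sqrt (K / a)" using K ab by simp
      ultimately show ?thesis unfolding B_def by linarith
    qed
    have "holo_on (chart Q c ` (cdom Q c \<inter> tdom Q i)) ?f"
      using s(1) unfolding holo_sections_def holo_fun_on_def by blast
    from holo_on_Schwarz[OF this cb[folded x_def] r _ bd \<open>y \<in> ball x r\<close>]
    have "cmod (?f y) \<le> B * (dist x y / r)"
      using s(2) inv[OF c] by (simp add: x_def)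
    then have "(cmod (?f y))\<^sup>2 \<le> (B * (dist x y / r))\<^sup>2"
      by (intro power_mono) auto
    also have "\<dots> = 4 * (K / a) * (dist x y / r)\<^sup>2"
      unfolding B_def power_mult_distrib using K ab by simp
    also have "\<dots> \<le> 4 * (K / a) * (a / (8 * b))"
    proof -
      have "dist x y / r \<le> sqrt (a / (8 * b))"
        using y r by (simp add: \<delta>_def field_simps)
      then have "(dist x y / r)\<^sup>2 \<le> (sqrt (a / (8 * b)))\<^sup>2"
        using r by (intro power_mono) auto
      then show ?thesis using K ab by (intro mult_left_mono) auto
    qed
    also have "\<dots> = K / (2 * b)" using ab by (simp add: field_simps)
    finally have "(cmod (?f y))\<^sup>2 * h y \<le> K / (2 * b) * b"
      using ab ab(3)[of y] pos[of y] \<open>y \<in> ball x r\<close> K by (intro mult_mono) auto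
    then show ?thesis
      using sqnorm_at_eq[OF sc qd(1)] inv[OF qd(2)] ab by (simp add: h_def y_def)
  qed
  moreover have "open U" unfolding U_def by (intro open_chart_nbhd manifold open_tdom)
  moreover have "p \<in> U" using i c \<delta> by (simp add: U_def chart_nbhd_def x_def)
  ultimately show ?thesis by blast
qed

lemma finitely_many_evaluations:
  "\<exists>E. \<forall>s\<in>holo_sections Q m. (\<forall>(i, p)\<in>set E. s i p = 0) \<longrightarrow> s = (\<lambda>i p. 0)"
proof -
  have "\<forall>p. \<exists>x. open (snd x) \<and> p \<in> snd x \<and> (\<forall>s\<in>holo_sections Q m. s (fst x) p = 0 \<longrightarrow>
     (\<forall>K>0. (\<forall>q. sqnorm_at m s q \<le> K) \<longrightarrow> (\<forall>q\<in>snd x. sqnorm_at m s q \<le> K / 2)))"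
    using local_decay by simp
  from choice[OF this] obtain x where x: "\<And>p. open (snd (x p)) \<and> p \<in> snd (x p) \<and>
     (\<forall>s\<in>holo_sections Q m. s (fst (x p)) p = 0 \<longrightarrow>
     (\<forall>K>0. (\<forall>q. sqnorm_at m s q \<le> K) \<longrightarrow> (\<forall>q\<in>snd (x p). sqnorm_at m s q \<le> K / 2)))"
    by blast
  define i where "i p = fst (x p)" for p
  define U where "U p = snd (x p)" for p
  have U: "open (U p)" "p \<in> U p" for p
    using x by (auto simp: U_def)
  have decay: "sqnorm_at m s q \<le> K / 2" if "s \<in> holo_sections Q m" "s (i p) p = 0" "0 < K"
      "\<And>q. sqnorm_at m s q \<le> K" "q \<in> U p" for p s K q
    using x[of p] that by (simp add: U_def i_def)
  have "UNIV \<subseteq> (\<Union>p\<in>UNIV. U p)"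
    using U(2) by auto
  from compactE_image[OF compact U(1) this]
  obtain A where A: "finite A" "UNIV \<subseteq> (\<Union>p\<in>A. U p)" .
  obtain xs where xs: "set xs = A" using finite_list[OF A(1)] by blast
  show ?thesis
  proof (intro exI ballI impI)
    fix s assume s: "s \<in> holo_sections Q m" "\<forall>(j, p)\<in>set (map (\<lambda>p. (i p, p)) xs). s j p = 0"
    note sc = holo_sections_continuous[OF s(1)]
    obtain q where q: "\<And>p. sqnorm_at m s p \<le> sqnorm_at m s q"
      using sqnorm_at_bounded[OF sc] by blast
    obtain p where p: "p \<in> A" "q \<in> U p" using A(2) by blast
    have "s (i p) p = 0" using s(2) p(1) xs by auto
    \<comment> \<open>With the maximum itself as \<open>K\<close>, decay at \<open>q\<close> would
      bound a positive maximum by its half.\<close>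
    then have "\<not> 0 < sqnorm_at m s q"
      using decay[OF s(1) _ _ q p(2)] by fastforce
    then have "sqnorm_at m s p = 0" for p
      using q[of p] sqnorm_at_nonneg[OF sc, of p] by linarith
    then show "s = (\<lambda>i p. 0)" by (rule sqnorm_at_eq_0_imp[OF sc])
  qed
qed

section \<open>Orthogonal projections\<close>

definition is_projection :: "nat \<Rightarrow> ('i \<Rightarrow> 'a \<Rightarrow> complex) \<Rightarrow> ('i \<Rightarrow> 'a \<Rightarrow> complex) \<Rightarrow> bool" where
  "is_projection m u t \<longleftrightarrow> t \<in> holo_sections Q m \<and>
     (\<forall>r \<in> holo_sections Q m. scalar_product Q m r (\<lambda>i p. u i p - t i p) = 0)"

lemma scalar_product_diff_right:
  assumes "r \<in> continuous_sections m" "s \<in> continuous_sections m" "t \<in> continuous_sections m"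
  shows "scalar_product Q m r (\<lambda>i p. s i p - t i p) = scalar_product Q m r s - scalar_product Q m r t"
  using scalar_product_lincomb_right[OF assms, of 1 "-1"] by simp

text \<open>The projection represents the conjugate-linear functional given by pairing with
  \<open>u\<close> on holomorphic sections; finitely many evaluations supply the finiteness required
  for this.\<close>

lemma is_projection_exists:
  assumes "u \<in> continuous_sections m"
  shows "\<exists>t. is_projection m u t"
proof -
  note c = holo_sections_continuous
  obtain E where E: "\<And>s. s \<in> holo_sections Q m \<Longrightarrow> (\<forall>(i, p)\<in>set E. s i p = 0) \<Longrightarrow> s = (\<lambda>i p. 0)"
    using finitely_many_evaluations[of m] by metis
  have "\<exists>t\<in>holo_sections Q m. \<forall>r\<in>holo_sections Q m. scalar_product Q m r t = scalar_product Q m r u"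
  proof (rule riesz_representation_of_evaluations[OF _ _ _ _ order_refl zero_holo_section])
    show "\<forall>s\<in>holo_sections Q m. \<forall>t\<in>holo_sections Q m. \<forall>a b. (\<lambda>i p. a * s i p + b * t i p) \<in> holo_sections Q m"
      using holo_sections_lincomb by blast
    show "\<forall>s\<in>holo_sections Q m. (\<forall>(i, p)\<in>set E. s i p = 0) \<longrightarrow> s = (\<lambda>i p. 0)"
      using E by blast
    fix s assume "s \<in> holo_sections Q m" "scalar_product Q m s s = 0"
    then show "s = (\<lambda>i p. 0)"
      by (intro sqnorm_eq_0_imp c) (auto simp: sqnorm_def)
  qed (simp_all add: scalar_product_lincomb_left scalar_product_lincomb_right c assms)
  then show ?thesis
    by (auto simp: is_projection_def scalar_product_diff_right c assms)
qed

lemma is_projection_scalar_product: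
  assumes "u \<in> continuous_sections m" "is_projection m u t" "r \<in> holo_sections Q m"
  shows "scalar_product Q m r t = scalar_product Q m r u"
  using assms scalar_product_diff_right[of r m u t]
  by (simp add: is_projection_def holo_sections_continuous)

lemma is_projection_unique:
  assumes "u \<in> continuous_sections m" "is_projection m u t" "is_projection m u t'"
  shows "t = t'"
proof -
  let ?d = "\<lambda>i p. 1 * t i p + (-1) * t' i p"
  have t: "t \<in> holo_sections Q m" "t' \<in> holo_sections Q m"
    using assms by (auto simp: is_projection_def)
  then have d: "?d \<in> holo_sections Q m" by (rule holo_sections_lincomb)
  note c = holo_sections_continuous
  have "scalar_product Q m ?d ?d = 1 * scalar_product Q m ?d t + (-1) * scalar_product Q m ?d t'"
    by (rule scalar_product_lincomb_right[OF c[OF d] c[OF t(1)] c[OF t(2)]])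
  then have "scalar_product Q m ?d ?d = 0"
    using is_projection_scalar_product[OF assms(1) _ d] assms(2,3) by simp
  then have "?d = (\<lambda>i p. 0)"
    by (intro sqnorm_eq_0_imp[OF c[OF d]]) (simp add: sqnorm_def)
  then show ?thesis by (simp add: fun_eq_iff)
qed

lemma holo_proj:
  assumes "u \<in> continuous_sections m"
  shows "is_projection m u (holo_proj Q m u)"
proof -
  have "\<exists>!t. is_projection m u t"
    using is_projection_exists[OF assms] is_projection_unique[OF assms] by blast
  then show ?thesis
    unfolding holo_proj_def is_projection_def[symmetric] by (rule theI')
qed

lemma holo_proj_eq:
  assumes "u \<in> continuous_sections m" "is_projection m u t"
  shows "holo_proj Q m u = t"
  using is_projection_unique[OF assms(1) holo_proj[OF assms(1)] assms(2)] .

lemma holo_proj_lincomb: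
  assumes "u \<in> continuous_sections m" "v \<in> continuous_sections m"
  shows "holo_proj Q m (\<lambda>i p. a * u i p + b * v i p) = (\<lambda>i p. a * holo_proj Q m u i p + b * holo_proj Q m v i p)"
proof (rule holo_proj_eq)
  show "(\<lambda>i p. a * u i p + b * v i p) \<in> continuous_sections m"
    using assms by (intro continuous_sections_lincomb) auto
  note P = holo_proj[OF assms(1)] holo_proj[OF assms(2)]
  let ?u = "\<lambda>i p. u i p - holo_proj Q m u i p" and ?v = "\<lambda>i p. v i p - holo_proj Q m v i p"
  have uv: "?u \<in> continuous_sections m" "?v \<in> continuous_sections m"
    using assms P by (auto simp: is_projection_def intro!: continuous_sections_diff intro: holo_sections_continuous)
  show "is_projection m (\<lambda>i p. a * u i p + b * v i p) (\<lambda>i p. a * holo_proj Q m u i p + b * holo_proj Q m v i p)"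
    unfolding is_projection_def
  proof (intro conjI ballI)
    show "(\<lambda>i p. a * holo_proj Q m u i p + b * holo_proj Q m v i p) \<in> holo_sections Q m"
      using P by (intro holo_sections_lincomb) (auto simp: is_projection_def)
    fix r assume r: "r \<in> holo_sections Q m"
    have "(\<lambda>i p. a * u i p + b * v i p - (a * holo_proj Q m u i p + b * holo_proj Q m v i p))
      = (\<lambda>i p. a * ?u i p + b * ?v i p)"
      by (simp add: fun_eq_iff algebra_simps)
    then show "scalar_product Q m r (\<lambda>i p. a * u i p + b * v i p - (a * holo_proj Q m u i p + b * holo_proj Q m v i p)) = 0"
      using P r scalar_product_lincomb_right[OF holo_sections_continuous[OF r] uv, of a b]
      by (simp add: is_projection_def)
  qed
qed

lemma holo_proj_holo:
  assumes "s \<in> holo_sections Q m"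
  shows "holo_proj Q m s = s"
proof (rule holo_proj_eq[OF holo_sections_continuous[OF assms]])
  have "scalar_product Q m r (\<lambda>i p. 0) = 0" for r
    by (simp add: scalar_product_def hprod_def Let_def)
  then show "is_projection m s s"
    using assms by (simp add: is_projection_def)
qed

lemma sqnorm_holo_proj_le:
  assumes "u \<in> continuous_sections m"
  shows "sqnorm m (holo_proj Q m u) \<le> sqnorm m u"
proof -
  let ?t = "holo_proj Q m u"
  let ?d = "\<lambda>i p. u i p - ?t i p"
  have t: "?t \<in> holo_sections Q m" and 0: "scalar_product Q m ?t ?d = 0"
    using holo_proj[OF assms] by (auto simp: is_projection_def)
  have d: "?d \<in> continuous_sections m"
    by (intro continuous_sections_diff assms holo_sections_continuous t)
  have "sqnorm m u = sqnorm m ?t + sqnorm m ?d"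
    using sqnorm_lincomb_eq[OF holo_sections_continuous[OF t] d, of 1 1] by (simp add: 0)
  then show ?thesis using sqnorm_nonneg[OF d] by simp
qed

section \<open>Toeplitz operators and their uniform bounds\<close>

lemma toeplitz_holo:
  assumes "continuous_on UNIV f" "s \<in> holo_sections Q m"
  shows "toeplitz Q m f s \<in> holo_sections Q m"
  using holo_proj[OF continuous_sections_scale[OF holo_sections_continuous[OF assms(2)] assms(1)]]
  by (simp add: toeplitz_def is_projection_def)

lemma toeplitz_one: "s \<in> holo_sections Q m \<Longrightarrow> toeplitz Q m (\<lambda>_. 1) s = s"
  by (simp add: toeplitz_def holo_proj_holo)

lemma toeplitz_lincomb_fun:
  assumes "continuous_on UNIV f" "continuous_on UNIV g" "s \<in> holo_sections Q m"
  shows "toeplitz Q m (\<lambda>p. a * f p + b * g p) s = (\<lambda>i p. a * toeplitz Q m f s i p + b * toeplitz Q m g s i p)"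
  using holo_proj_lincomb[of "\<lambda>i p. f p * s i p" m "\<lambda>i p. g p * s i p" a b] assms
  by (simp add: toeplitz_def continuous_sections_scale holo_sections_continuous algebra_simps)

lemma toeplitz_scale:
  assumes "continuous_on UNIV f" "s \<in> holo_sections Q m"
  shows "toeplitz Q m f (\<lambda>i p. a * s i p) = (\<lambda>i p. a * toeplitz Q m f s i p)"
  using holo_proj_lincomb[of "\<lambda>i p. f p * s i p" m "\<lambda>i p. f p * s i p" a 0] assms
  by (simp add: toeplitz_def continuous_sections_scale holo_sections_continuous mult.left_commute)

text \<open>The pointwise norm grows at most by the maximum of \<open>f\<close>, and projecting does
  not increase the norm. One constant serves all \<open>m\<close>, so composing a remainder with a
  Toeplitz operator keeps its order.\<close>

lemma toeplitz_bounded: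
  assumes f: "continuous_on UNIV f"
  shows "\<exists>K. \<forall>m. \<forall>s\<in>holo_sections Q m. sqnorm m (toeplitz Q m f s) \<le> K * sqnorm m s"
proof -
  obtain q where q: "\<And>p. cmod (f p) \<le> cmod (f q)"
    using continuous_attains_sup[OF compact, of "\<lambda>p. cmod (f p)"] continuous_on_norm[OF f] by auto
  have "sqnorm m (toeplitz Q m f s) \<le> (cmod (f q))\<^sup>2 * sqnorm m s" if "s \<in> holo_sections Q m" for m s
  proof -
    note s = holo_sections_continuous[OF that]
    note fs = continuous_sections_scale[OF s f]
    have "sqnorm_at m (\<lambda>i p. f p * s i p) p \<le> (cmod (f q))\<^sup>2 * sqnorm_at m s p" for p
    proof -
      obtain i where i: "p \<in> tdom Q i" using tdom_cover by blast
      have "sqnorm_at m (\<lambda>i p. f p * s i p) p = (cmod (f p))\<^sup>2 * sqnorm_at m s p"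
        using sqnorm_at_eq[OF s i] sqnorm_at_eq[OF fs i] by (simp add: norm_mult power_mult_distrib)
      also have "\<dots> \<le> (cmod (f q))\<^sup>2 * sqnorm_at m s p"
        using q sqnorm_at_nonneg[OF s] by (intro mult_right_mono power_mono) auto
      finally show ?thesis .
    qed
    then have "(LINT p|vol Q. sqnorm_at m (\<lambda>i p. f p * s i p) p) \<le> (LINT p|vol Q. (cmod (f q))\<^sup>2 * sqnorm_at m s p)"
      by (intro integral_mono integrable_mult_right integrable_vol_continuous continuous_sqnorm_at s fs)
    then have "sqnorm m (\<lambda>i p. f p * s i p) \<le> (cmod (f q))\<^sup>2 * sqnorm m s"
      by (simp add: sqnorm_eq_integral s fs)
    then show ?thesis
      using sqnorm_holo_proj_le[OF fs] by (simp add: toeplitz_def)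
  qed
  then show ?thesis by blast
qed

end

section \<open>Toeplitz asymptotics\<close>

context quantized_manifold
begin

text \<open>Homogeneity carries estimates from the unit ball to all sections; boundedness makes the
  supremum in \<open>op_norm\<close> a genuine upper bound.\<close>

definition bounded_op :: "nat \<Rightarrow> (('i \<Rightarrow> 'a \<Rightarrow> complex) \<Rightarrow> 'i \<Rightarrow> 'a \<Rightarrow> complex) \<Rightarrow> bool" where
  "bounded_op m A \<longleftrightarrow> (\<forall>s\<in>holo_sections Q m. A s \<in> holo_sections Q m \<and> (\<forall>c. A (\<lambda>i p. c * s i p) = (\<lambda>i p. c * A s i p))) \<and>
     (\<exists>K. \<forall>s\<in>holo_sections Q m. sqnorm m (A s) \<le> K * sqnorm m s)"

text \<open>Operator norms of order m^(-N), phrased for single sections so that sums and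
  compositions involve no supremum.\<close>

definition decays :: "nat \<Rightarrow> (nat \<Rightarrow> ('i \<Rightarrow> 'a \<Rightarrow> complex) \<Rightarrow> 'i \<Rightarrow> 'a \<Rightarrow> complex) \<Rightarrow> bool" where
  "decays N A \<longleftrightarrow> (\<forall>m. bounded_op m (A m)) \<and>
     (\<exists>K. \<forall>m\<ge>1. \<forall>s\<in>holo_sections Q m. sqnorm m (A m s) \<le> K * (1 / real m ^ N)\<^sup>2 * sqnorm m s)"

lemma holo_sections_scale: "s \<in> holo_sections Q m \<Longrightarrow> (\<lambda>i p. c * s i p) \<in> holo_sections Q m"
  using holo_sections_lincomb[of s m s c 0] by simp

lemma bounded_op_cong:
  assumes "bounded_op m A" "\<And>s. s \<in> holo_sections Q m \<Longrightarrow> A s = B s"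
  shows "bounded_op m B"
  using assms unfolding bounded_op_def by (simp add: holo_sections_scale)

lemma decays_cong:
  assumes "decays N A" "\<And>m s. s \<in> holo_sections Q m \<Longrightarrow> A m s = B m s"
  shows "decays N B"
  using assms bounded_op_cong unfolding decays_def by (metis (no_types, lifting))

lemma sqnorm_holo_nonneg: "s \<in> holo_sections Q m \<Longrightarrow> 0 \<le> sqnorm m s"
  by (intro sqnorm_nonneg holo_sections_continuous)

lemma sqnorm_lincomb_bound:
  assumes "s \<in> holo_sections Q m" "u \<in> holo_sections Q m" "t \<in> holo_sections Q m"
    "sqnorm m s \<le> K * e * sqnorm m u" "sqnorm m t \<le> L * e * sqnorm m u"
  shows "sqnorm m (\<lambda>i p. a * s i p + b * t i p) \<le> (2 * (cmod a)\<^sup>2 * K + 2 * (cmod b)\<^sup>2 * L) * e * sqnorm m u"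
proof -
  have "sqnorm m (\<lambda>i p. a * s i p + b * t i p) \<le> 2 * (cmod a)\<^sup>2 * sqnorm m s + 2 * (cmod b)\<^sup>2 * sqnorm m t"
    by (intro sqnorm_lincomb holo_sections_continuous assms)
  also have "\<dots> \<le> 2 * (cmod a)\<^sup>2 * (K * e * sqnorm m u) + 2 * (cmod b)\<^sup>2 * (L * e * sqnorm m u)"
    by (intro add_mono mult_left_mono assms) auto
  finally show ?thesis by (simp add: algebra_simps)
qed

lemma bounded_op_lincomb:
  assumes "bounded_op m A" "bounded_op m B"
  shows "bounded_op m (\<lambda>s i p. a * A s i p + b * B s i p)"
proof -
  obtain K L where "\<forall>s\<in>holo_sections Q m. sqnorm m (A s) \<le> K * 1 * sqnorm m s"
    "\<forall>s\<in>holo_sections Q m. sqnorm m (B s) \<le> L * 1 * sqnorm m s"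
    using assms unfolding bounded_op_def by auto
  then have "\<forall>s\<in>holo_sections Q m. sqnorm m (\<lambda>i p. a * A s i p + b * B s i p)
      \<le> (2 * (cmod a)\<^sup>2 * K + 2 * (cmod b)\<^sup>2 * L) * 1 * sqnorm m s"
    using assms unfolding bounded_op_def by (intro ballI sqnorm_lincomb_bound) auto
  then have "\<exists>K. \<forall>s\<in>holo_sections Q m. sqnorm m (\<lambda>i p. a * A s i p + b * B s i p) \<le> K * sqnorm m s"
    unfolding mult_1_right by (rule exI)
  then show ?thesis
    using assms by (simp add: bounded_op_def holo_sections_lincomb algebra_simps)
qed

lemma decays_lincomb:
  assumes "decays N A" "decays N B"
  shows "decays N (\<lambda>m s i p. a * A m s i p + b * B m s i p)"
proof -
  obtain K L where K: "\<And>m s. m \<ge> 1 \<Longrightarrow> s \<in> holo_sections Q m \<Longrightarrow> sqnorm m (A m s) \<le> K * (1 / real m ^ N)\<^sup>2 * sqnorm m s"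
    and L: "\<And>m s. m \<ge> 1 \<Longrightarrow> s \<in> holo_sections Q m \<Longrightarrow> sqnorm m (B m s) \<le> L * (1 / real m ^ N)\<^sup>2 * sqnorm m s"
    using assms unfolding decays_def by metis
  have "A m s \<in> holo_sections Q m" "B m s \<in> holo_sections Q m" if "s \<in> holo_sections Q m" for m s
    using assms that unfolding decays_def bounded_op_def by blast+
  then have "\<forall>m\<ge>1. \<forall>s\<in>holo_sections Q m. sqnorm m (\<lambda>i p. a * A m s i p + b * B m s i p)
      \<le> (2 * (cmod a)\<^sup>2 * K + 2 * (cmod b)\<^sup>2 * L) * (1 / real m ^ N)\<^sup>2 * sqnorm m s"
    using K L by (intro allI impI ballI sqnorm_lincomb_bound) auto
  moreover have "bounded_op m (\<lambda>s i p. a * A m s i p + b * B m s i p)" for m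
    using assms unfolding decays_def by (intro bounded_op_lincomb) auto
  ultimately show ?thesis unfolding decays_def by blast
qed

lemma bounded_op_scale: "bounded_op m A \<Longrightarrow> bounded_op m (\<lambda>s i p. a * A s i p)"
  using bounded_op_lincomb[of m A A a 0] by simp

lemma bounded_op_zero: "bounded_op m (\<lambda>s i p. 0)"
  unfolding bounded_op_def by (auto simp: zero_holo_section sqnorm_zero intro!: exI[of _ 0])

lemma decays_zero: "decays N (\<lambda>m s i p. 0)"
  unfolding decays_def by (auto simp: bounded_op_zero sqnorm_zero intro!: exI[of _ 0])

lemma bounded_op_sum:
  assumes "finite I" "\<And>k. k \<in> I \<Longrightarrow> bounded_op m (A k)"
  shows "bounded_op m (\<lambda>s i p. \<Sum>k\<in>I. A k s i p)"
  using assms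
proof (induction I rule: finite_induct)
  case empty
  then show ?case by (simp add: bounded_op_zero)
next
  case (insert k I)
  then show ?case
    using bounded_op_lincomb[of m "A k" "\<lambda>s i p. \<Sum>k\<in>I. A k s i p" 1 1] by simp
qed

lemma decays_sum:
  assumes "finite I" "\<And>k. k \<in> I \<Longrightarrow> decays N (A k)"
  shows "decays N (\<lambda>m s i p. \<Sum>k\<in>I. A k m s i p)"
  using assms
proof (induction I rule: finite_induct)
  case empty
  then show ?case by (simp add: decays_zero)
next
  case (insert k I)
  then show ?case
    using decays_lincomb[of N "A k" "\<lambda>m s i p. \<Sum>k\<in>I. A k m s i p" 1 1] by simp
qed

lemma decays_shift:
  assumes "decays N A"
  shows "decays (k + N) (\<lambda>m s i p. of_real (1 / real m ^ k) * A m s i p)"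
proof -
  obtain K where K: "\<And>m s. m \<ge> 1 \<Longrightarrow> s \<in> holo_sections Q m \<Longrightarrow> sqnorm m (A m s) \<le> K * (1 / real m ^ N)\<^sup>2 * sqnorm m s"
    using assms unfolding decays_def by metis
  have "sqnorm m (\<lambda>i p. of_real (1 / real m ^ k) * A m s i p) \<le> K * (1 / real m ^ (k + N))\<^sup>2 * sqnorm m s"
    if "m \<ge> 1" "s \<in> holo_sections Q m" for m s
  proof -
    have "sqnorm m (\<lambda>i p. of_real (1 / real m ^ k) * A m s i p) = (1 / real m ^ k)\<^sup>2 * sqnorm m (A m s)"
      unfolding sqnorm_scale norm_of_real by simp
    also have "\<dots> \<le> (1 / real m ^ k)\<^sup>2 * (K * (1 / real m ^ N)\<^sup>2 * sqnorm m s)"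
      by (intro mult_left_mono K that) auto
    also have "\<dots> = K * ((1 / real m ^ k) * (1 / real m ^ N))\<^sup>2 * sqnorm m s"
      by (simp only: power_mult_distrib ac_simps)
    also have "(1 / real m ^ k) * (1 / real m ^ N) = 1 / real m ^ (k + N)"
      by (simp add: power_add)
    finally show ?thesis .
  qed
  moreover have "bounded_op m (\<lambda>s i p. of_real (1 / real m ^ k) * A m s i p)" for m
    using assms unfolding decays_def by (intro bounded_op_scale) blast
  ultimately show ?thesis unfolding decays_def by blast
qed

lemma toeplitz_bounded_op:
  assumes "continuous_on UNIV f"
  shows "bounded_op m (toeplitz Q m f)"
  using toeplitz_bounded[OF assms] toeplitz_holo[OF assms] toeplitz_scale[OF assms]
  unfolding bounded_op_def by blast

lemma bounded_op_comp:
  assumes "bounded_op m A" "bounded_op m B"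
  shows "bounded_op m (\<lambda>s. A (B s))"
proof -
  obtain K L where K: "\<And>s. s \<in> holo_sections Q m \<Longrightarrow> sqnorm m (A s) \<le> K * sqnorm m s"
    and L: "\<And>s. s \<in> holo_sections Q m \<Longrightarrow> sqnorm m (B s) \<le> L * sqnorm m s"
    using assms unfolding bounded_op_def by blast
  have "sqnorm m (A (B s)) \<le> (max K 0 * L) * sqnorm m s" if s: "s \<in> holo_sections Q m" for s
  proof -
    have Bs: "B s \<in> holo_sections Q m" using assms s unfolding bounded_op_def by blast
    have "sqnorm m (A (B s)) \<le> K * sqnorm m (B s)" by (rule K[OF Bs])
    \<comment> \<open>The constant obtained may be negative, whereas monotonicity of multiplication
      asks for a nonnegative one.\<close>
    also have "\<dots> \<le> max K 0 * sqnorm m (B s)"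
      by (intro mult_right_mono sqnorm_holo_nonneg Bs) auto
    also have "\<dots> \<le> max K 0 * (L * sqnorm m s)"
      by (intro mult_left_mono L s) auto
    finally show ?thesis by simp
  qed
  then have "\<exists>K. \<forall>s\<in>holo_sections Q m. sqnorm m (A (B s)) \<le> K * sqnorm m s" by blast
  then show ?thesis
    using assms unfolding bounded_op_def by simp
qed

lemma decays_comp_toeplitz:
  assumes A: "decays N A" and g: "continuous_on UNIV g"
  shows "decays N (\<lambda>m s. A m (toeplitz Q m g s))"
proof -
  obtain K where K: "\<And>m s. m \<ge> 1 \<Longrightarrow> s \<in> holo_sections Q m \<Longrightarrow> sqnorm m (A m s) \<le> K * (1 / real m ^ N)\<^sup>2 * sqnorm m s"
    using A unfolding decays_def by metis
  obtain L where L: "\<And>m s. s \<in> holo_sections Q m \<Longrightarrow> sqnorm m (toeplitz Q m g s) \<le> L * sqnorm m s"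
    using toeplitz_bounded[OF g] by blast
  have "sqnorm m (A m (toeplitz Q m g s)) \<le> (max K 0 * L) * (1 / real m ^ N)\<^sup>2 * sqnorm m s"
    if m: "m \<ge> 1" and s: "s \<in> holo_sections Q m" for m s
  proof -
    let ?e = "(1 / real m ^ N)\<^sup>2"
    have t: "toeplitz Q m g s \<in> holo_sections Q m" by (rule toeplitz_holo[OF g s])
    have "sqnorm m (A m (toeplitz Q m g s)) \<le> K * ?e * sqnorm m (toeplitz Q m g s)"
      by (rule K[OF m t])
    also have "\<dots> \<le> max K 0 * ?e * sqnorm m (toeplitz Q m g s)"
      by (intro mult_right_mono sqnorm_holo_nonneg t) auto
    also have "\<dots> \<le> max K 0 * ?e * (L * sqnorm m s)"
      by (intro mult_left_mono L s) auto
    finally show ?thesis by (simp add: mult.assoc mult.left_commute)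
  qed
  moreover have "bounded_op m (\<lambda>s. A m (toeplitz Q m g s))" for m
    using A bounded_op_comp[OF _ toeplitz_bounded_op[OF g]] unfolding decays_def by blast
  ultimately show ?thesis unfolding decays_def by blast
qed

lemma section_norm_eq: "section_norm Q m s = sqrt (sqnorm m s)"
  by (simp add: section_norm_def sqnorm_def)

text \<open>In one direction the supremum is bounded termwise, the zero section making its set
  nonempty. In the other a nonzero section is scaled to norm 1, where the supremum applies.\<close>

lemma decays_iff_op_norm:
  assumes "\<And>m. bounded_op m (A m)"
  shows "decays N A \<longleftrightarrow> (\<exists>K. \<forall>m\<ge>1. op_norm Q m (A m) \<le> K * (1 / real m ^ N))"
proof
  assume "decays N A"
  then obtain K where K: "\<And>m s. m \<ge> 1 \<Longrightarrow> s \<in> holo_sections Q m \<Longrightarrow> sqnorm m (A m s) \<le> K * (1 / real m ^ N)\<^sup>2 * sqnorm m s"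
    unfolding decays_def by metis
  have "op_norm Q m (A m) \<le> sqrt (max K 0) * (1 / real m ^ N)" if m: "m \<ge> 1" for m
    unfolding op_norm_def
  proof (rule cSup_least)
    show "{section_norm Q m (A m s) |s. s \<in> holo_sections Q m \<and> section_norm Q m s \<le> 1} \<noteq> {}"
      using zero_holo_section[of m] by (auto simp: section_norm_eq sqnorm_zero intro!: exI[of _ "\<lambda>i p. 0"])
    fix x assume "x \<in> {section_norm Q m (A m s) |s. s \<in> holo_sections Q m \<and> section_norm Q m s \<le> 1}"
    then obtain s where s: "s \<in> holo_sections Q m" "sqnorm m s \<le> 1" and x: "x = sqrt (sqnorm m (A m s))"
      by (auto simp: section_norm_eq)
    let ?e = "(1 / real m ^ N)\<^sup>2"
    have "sqnorm m (A m s) \<le> K * ?e * sqnorm m s" by (rule K[OF m s(1)])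
    also have "\<dots> \<le> max K 0 * ?e * sqnorm m s"
      by (intro mult_right_mono sqnorm_holo_nonneg s) auto
    also have "\<dots> \<le> max K 0 * ?e * 1"
      by (intro mult_left_mono s) auto
    finally have "x \<le> sqrt (max K 0 * ?e)" unfolding x by simp
    also have "\<dots> = sqrt (max K 0) * (1 / real m ^ N)"
      unfolding real_sqrt_mult real_sqrt_abs by simp
    finally show "x \<le> sqrt (max K 0) * (1 / real m ^ N)" .
  qed
  then show "\<exists>K. \<forall>m\<ge>1. op_norm Q m (A m) \<le> K * (1 / real m ^ N)" by blast
next
  assume "\<exists>K. \<forall>m\<ge>1. op_norm Q m (A m) \<le> K * (1 / real m ^ N)"
  then obtain K where K: "\<And>m. m \<ge> 1 \<Longrightarrow> op_norm Q m (A m) \<le> K * (1 / real m ^ N)" by blast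
  have "sqnorm m (A m s) \<le> K\<^sup>2 * (1 / real m ^ N)\<^sup>2 * sqnorm m s"
    if m: "m \<ge> 1" and s: "s \<in> holo_sections Q m" for m s
  proof (cases "sqnorm m s = 0")
    case True
    \<comment> \<open>Such a section cannot be normalized; homogeneity with factor 0 shows that its
      image is zero.\<close>
    then have "s = (\<lambda>i p. 0 * s i p)"
      using sqnorm_eq_0_imp[OF holo_sections_continuous[OF s]] by simp
    then have "A m s = (\<lambda>i p. 0 * A m s i p)"
      using assms[of m] s unfolding bounded_op_def by metis
    then show ?thesis using True sqnorm_zero[of m] by simp
  next
    case False
    then have pos: "0 < sqnorm m s" using sqnorm_holo_nonneg[OF s] by simp
    define c where "c = complex_of_real (1 / sqrt (sqnorm m s))"
    have c: "(cmod c)\<^sup>2 = 1 / sqnorm m s"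
      unfolding c_def norm_of_real using pos by (simp add: power_divide)
    let ?t = "\<lambda>i p. c * s i p"
    have t: "?t \<in> holo_sections Q m" by (rule holo_sections_scale[OF s])
    have nt: "sqnorm m ?t = 1" unfolding sqnorm_scale c using pos by simp
    have At: "A m ?t = (\<lambda>i p. c * A m s i p)"
      using assms[of m] s unfolding bounded_op_def by blast
    have "bdd_above {section_norm Q m (A m s) |s. s \<in> holo_sections Q m \<and> section_norm Q m s \<le> 1}"
    proof -
      obtain L where L: "\<And>s. s \<in> holo_sections Q m \<Longrightarrow> sqnorm m (A m s) \<le> L * sqnorm m s"
        using assms[of m] unfolding bounded_op_def by blast
      have "sqrt (sqnorm m (A m s)) \<le> sqrt (max L 0)" if "s \<in> holo_sections Q m" "sqnorm m s \<le> 1" for s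
      proof -
        have "sqnorm m (A m s) \<le> L * sqnorm m s" by (rule L[OF that(1)])
        also have "\<dots> \<le> max L 0 * sqnorm m s"
          by (intro mult_right_mono sqnorm_holo_nonneg that) auto
        also have "\<dots> \<le> max L 0 * 1"
          by (intro mult_left_mono that) auto
        finally show ?thesis by simp
      qed
      then show ?thesis
        by (intro bdd_aboveI[of _ "sqrt (max L 0)"]) (auto simp: section_norm_eq)
    qed
    then have "section_norm Q m (A m ?t) \<le> op_norm Q m (A m)"
      unfolding op_norm_def using t nt by (intro cSup_upper) (auto simp: section_norm_eq)
    also have "\<dots> \<le> K * (1 / real m ^ N)" by (rule K[OF m])
    finally have "sqrt (sqnorm m (A m ?t)) \<le> K * (1 / real m ^ N)"
      by (simp only: section_norm_eq)
    then have "sqnorm m (A m ?t) \<le> (K * (1 / real m ^ N))\<^sup>2"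
      by (rule sqrt_le_D)
    then have "sqnorm m (A m s) / sqnorm m s \<le> K\<^sup>2 * (1 / real m ^ N)\<^sup>2"
      unfolding At sqnorm_scale c power_mult_distrib by simp
    then show ?thesis using pos by (simp only: divide_le_eq if_True)
  qed
  then show "decays N A" using assms unfolding decays_def by blast
qed

lemma toeplitz_sum:
  assumes "finite I" "\<And>k. k \<in> I \<Longrightarrow> continuous_on UNIV (f k)" "s \<in> holo_sections Q m"
  shows "toeplitz Q m (\<lambda>p. \<Sum>k\<in>I. f k p) s = (\<lambda>i p. \<Sum>k\<in>I. toeplitz Q m (f k) s i p)"
  using assms(1,2)
proof (induction I rule: finite_induct)
  case empty
  then show ?case
    using toeplitz_lincomb_fun[of "\<lambda>_. 0" "\<lambda>_. 0" s m 0 0] assms(3) by simp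
next
  case (insert k I)
  have "continuous_on UNIV (\<lambda>p. \<Sum>k\<in>I. f k p)"
    using insert.prems by (intro continuous_intros) auto
  then have "toeplitz Q m (\<lambda>p. 1 * f k p + 1 * (\<Sum>k\<in>I. f k p)) s
    = (\<lambda>i p. 1 * toeplitz Q m (f k) s i p + 1 * toeplitz Q m (\<lambda>p. \<Sum>k\<in>I. f k p) s i p)"
    using insert.prems by (intro toeplitz_lincomb_fun assms(3)) auto
  then show ?case using insert by simp
qed

lemma toeplitz_zero: "s \<in> holo_sections Q m \<Longrightarrow> toeplitz Q m (\<lambda>_. 0) s = (\<lambda>i p. 0)"
  using toeplitz_sum[of "{}" "\<lambda>_ _. 0" s m] by simp

end

section \<open>Toeplitz asymptotics of the twisted product\<close>

locale berezin_toeplitz = quantized_manifold Q + star_algebra Q C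
  for Q :: "('a::t2_space, 'n::finite, 'c, 'i) quantum_data" and C +
  assumes asymptotics: "toeplitz_asymptotics Q C"
begin

lemma smooth_continuous: "smooth_fun Q f \<Longrightarrow> continuous_on UNIV (f :: 'a \<Rightarrow> complex)"
  by (rule smooth_fun_on_imp_continuous_on[OF manifold open_UNIV])

text \<open>The coefficients \<open>D\<close> are a parameter because remainders occur both for
  \<star> and for its twist.\<close>

definition defect :: "(nat \<Rightarrow> ('a \<Rightarrow> complex) \<Rightarrow> ('a \<Rightarrow> complex) \<Rightarrow> 'a \<Rightarrow> complex) \<Rightarrow> nat
    \<Rightarrow> ('a \<Rightarrow> complex) \<Rightarrow> ('a \<Rightarrow> complex) \<Rightarrow> nat \<Rightarrow> ('i \<Rightarrow> 'a \<Rightarrow> complex) \<Rightarrow> 'i \<Rightarrow> 'a \<Rightarrow> complex" where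
  "defect D N f g m s i p = toeplitz Q m f (toeplitz Q m g s) i p
     - (\<Sum>j<N. of_real (1 / real m ^ j) * toeplitz Q m (D j f g) s i p)"

lemma bounded_op_defect:
  assumes "smooth_fun Q f" "smooth_fun Q g" "\<And>j. smooth_fun Q (D j f g)"
  shows "bounded_op m (defect D N f g m)"
proof -
  have T: "bounded_op m (toeplitz Q m h)" if "smooth_fun Q h" for h
    by (intro toeplitz_bounded_op smooth_continuous that)
  have "bounded_op m (\<lambda>s i p. of_real (1 / real m ^ j) * toeplitz Q m (D j f g) s i p)" for j
    by (rule bounded_op_scale[OF T[OF assms(3)]])
  then have "bounded_op m (\<lambda>s i p. \<Sum>j<N. of_real (1 / real m ^ j) * toeplitz Q m (D j f g) s i p)"
    by (rule bounded_op_sum[OF finite_lessThan])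
  from bounded_op_lincomb[OF bounded_op_comp[OF T[OF assms(1)] T[OF assms(2)]] this, of 1 "-1"]
  have "bounded_op m (\<lambda>s i p. 1 * toeplitz Q m f (toeplitz Q m g s) i p
     + (-1) * (\<Sum>j<N. of_real (1 / real m ^ j) * toeplitz Q m (D j f g) s i p))" .
  then show ?thesis by (rule bounded_op_cong) (simp add: defect_def fun_eq_iff)
qed

lemma toeplitz_asymptotics_iff:
  assumes "\<And>j f g. smooth_fun Q f \<Longrightarrow> smooth_fun Q g \<Longrightarrow> smooth_fun Q (D j f g)"
  shows "toeplitz_asymptotics Q D \<longleftrightarrow>
    (\<forall>f g N. smooth_fun Q f \<longrightarrow> smooth_fun Q g \<longrightarrow> 1 \<le> N \<longrightarrow> decays N (defect D N f g))"
proof -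
  have "decays N (defect D N f g) \<longleftrightarrow> (\<exists>K. \<forall>m\<ge>1.
           op_norm Q m (\<lambda>s i p. toeplitz Q m f (toeplitz Q m g s) i p
             - (\<Sum>j<N. of_real (1 / real m ^ j) * toeplitz Q m (D j f g) s i p)) \<le> K * (1 / real m ^ N))"
    if "smooth_fun Q f" "smooth_fun Q g" for f g N
    using decays_iff_op_norm[OF bounded_op_defect[of f g D _ N], of N] that assms
    unfolding defect_def[abs_def] by simp
  then show ?thesis unfolding toeplitz_asymptotics_def by simp
qed

lemma sum_lessThan_triangle:
  "(\<Sum>k<N. \<Sum>i<N - k. h k i) = (\<Sum>j<N. \<Sum>i\<le>j. h (j - i) (i::nat) :: 'b::comm_monoid_add)"
  unfolding sum.Sigma[OF finite_lessThan ballI[OF finite_lessThan]] sum.Sigma[OF finite_lessThan ballI[OF finite_atMost]]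
  by (rule sum.reindex_bij_witness[of _ "\<lambda>(j, i). (j - i, i)" "\<lambda>(k, i). (k + i, i)"]) auto

text \<open>The coefficient \<open>x k\<close> carries the factor m^(-k), so its product with
  \<open>g\<close> is expanded to \<open>N - k\<close> terms only, at least one since
  \<open>k < N\<close>. Collected by total order, these expansions are exactly the terms of the
  product series below \<open>N\<close>, with nothing left over.\<close>

lemma series_asymptotics:
  assumes x: "smooth_series x" and g: "smooth_fun Q g"
  shows "decays N (\<lambda>m s i p. (\<Sum>k<N. of_real (1 / real m ^ k) * toeplitz Q m (x k) (toeplitz Q m g s) i p)
    - (\<Sum>j<N. of_real (1 / real m ^ j) * toeplitz Q m ((x \<star> const_series g) j) s i p))"
proof -
  have "decays N (\<lambda>m s i p. of_real (1 / real m ^ k) * defect C (N - k) (x k) g m s i p)" if "k < N" for k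
  proof -
    have "decays (N - k) (defect C (N - k) (x k) g)"
      using toeplitz_asymptotics_iff[THEN iffD1, OF C_smooth asymptotics] that x g by simp
    from decays_shift[OF this, of k] show ?thesis using that by simp
  qed
  then have "decays N (\<lambda>m s i p. \<Sum>k<N. of_real (1 / real m ^ k) * defect C (N - k) (x k) g m s i p)"
    by (intro decays_sum) auto
  then show ?thesis
  proof (rule decays_cong, intro ext)
    fix m s i p assume s: "s \<in> holo_sections Q m"
    let ?T = "\<lambda>f. toeplitz Q m f s i p"
    have "(\<Sum>k<N. of_real (1 / real m ^ k) * (\<Sum>j<N - k. of_real (1 / real m ^ j) * ?T (C j (x k) g)))
      = (\<Sum>k<N. \<Sum>j<N - k. of_real (1 / real m ^ (k + j)) * ?T (C j (x k) g))"
      by (simp add: sum_distrib_left power_add)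
    also have "\<dots> = (\<Sum>j<N. \<Sum>l\<le>j. of_real (1 / real m ^ (j - l + l)) * ?T (C l (x (j - l)) g))"
      by (rule sum_lessThan_triangle)
    also have "\<dots> = (\<Sum>j<N. of_real (1 / real m ^ j) * ?T ((x \<star> const_series g) j))"
    proof (rule sum.cong[OF refl])
      fix j
      have "(x \<star> const_series g) j = (\<lambda>p. \<Sum>l\<le>j. C l (x (j - l)) g p)"
        using star_const_right[OF x g] by blast
      then have "?T ((x \<star> const_series g) j) = (\<Sum>l\<le>j. ?T (C l (x (j - l)) g))"
        using toeplitz_sum[of "{..j}" "\<lambda>l. C l (x (j - l)) g", OF finite_atMost _ s] x g
        by (simp add: smooth_continuous C_smooth)
      then show "(\<Sum>l\<le>j. of_real (1 / real m ^ (j - l + l)) * ?T (C l (x (j - l)) g))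
        = of_real (1 / real m ^ j) * ?T ((x \<star> const_series g) j)"
        by (simp add: sum_distrib_left)
    qed
    finally show "(\<Sum>k<N. of_real (1 / real m ^ k) * defect C (N - k) (x k) g m s i p)
      = (\<Sum>k<N. of_real (1 / real m ^ k) * toeplitz Q m (x k) (toeplitz Q m g s) i p)
        - (\<Sum>j<N. of_real (1 / real m ^ j) * toeplitz Q m ((x \<star> const_series g) j) s i p)"
      by (simp only: defect_def right_diff_distrib sum_subtractf)
  qed
qed

lemma twisted_asymptotics: "toeplitz_asymptotics Q twisted"
proof (subst toeplitz_asymptotics_iff)
  show "smooth_fun Q (twisted j f g)" if "smooth_fun Q f" "smooth_fun Q g" for j f g
    using twisted_star_product that unfolding star_product_def by blast
  show "\<forall>f g N. smooth_fun Q f \<longrightarrow> smooth_fun Q g \<longrightarrow> 1 \<le> N \<longrightarrow> decays N (defect twisted N f g)"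
  proof (intro allI impI)
    fix f g :: "'a \<Rightarrow> complex" and N :: nat
    assume f: "smooth_fun Q f" and g: "smooth_fun Q g" and N: "1 \<le> N"
    define x where "x = const_series f \<star> one_inv"
    have x: "smooth_series x"
      unfolding x_def by (intro smooth_star_one_inv smooth_const_series f)
    have x1: "x \<star> one = const_series f"
      unfolding x_def
      by (simp add: star_assoc smooth_const_series f smooth_one_inv smooth_one one_inv_star_one star_unit)
    have xg: "(x \<star> const_series g) j = twisted j f g" for j
      by (simp add: x_def twisted_def)
    note g' = smooth_continuous[OF g]
    \<comment> \<open>One remainder for \<open>x \<star> g\<close>, and one for
      \<open>x \<star> one\<close> applied after T_g. As T_1 is the identity, the truncated sums for
      T_x T_g agree and cancel in the difference.\<close>
    from decays_lincomb[OF series_asymptotics[OF x g, of N]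
        decays_comp_toeplitz[OF series_asymptotics[OF x smooth_fun_on_const, of N 1] g'], of 1 "-1"]
    show "decays N (defect twisted N f g)"
    proof (rule decays_cong, intro ext)
      fix m s i p assume s: "s \<in> holo_sections Q m"
      let ?t = "toeplitz Q m g s"
      have t: "?t \<in> holo_sections Q m" by (rule toeplitz_holo[OF g' s])
      \<comment> \<open>Since \<open>1 \<le> N\<close>, the sum contains the index 0, the only one
        where the constant series can be nonzero.\<close>
      have "(\<Sum>j<N. of_real (1 / real m ^ j) * toeplitz Q m (const_series f j) ?t i p)
        = (\<Sum>j\<in>{0}. of_real (1 / real m ^ j) * toeplitz Q m (const_series f j) ?t i p)"
        using N by (intro sum.mono_neutral_right) (auto simp: const_series_simps toeplitz_zero t)
      then have f1: "(\<Sum>j<N. of_real (1 / real m ^ j) * toeplitz Q m (const_series f j) ?t i p) = toeplitz Q m f ?t i p"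
        by (simp add: const_series_simps)
      show "1 * ((\<Sum>k<N. of_real (1 / real m ^ k) * toeplitz Q m (x k) ?t i p)
          - (\<Sum>j<N. of_real (1 / real m ^ j) * toeplitz Q m ((x \<star> const_series g) j) s i p))
        + - 1 * ((\<Sum>k<N. of_real (1 / real m ^ k) * toeplitz Q m (x k) (toeplitz Q m (\<lambda>_. 1) ?t) i p)
          - (\<Sum>j<N. of_real (1 / real m ^ j) * toeplitz Q m ((x \<star> one) j) ?t i p))
        = defect twisted N f g m s i p"
        unfolding x1 xg toeplitz_one[OF t] f1 defect_def by simp
    qed
  qed
qed

end

theorem proposition5p1:
  fixes Q :: "('a::t2_space, 'n::finite, 'c, 'i) quantum_data"
    and C :: "nat \<Rightarrow> ('a \<Rightarrow> complex) \<Rightarrow> ('a \<Rightarrow> complex) \<Rightarrow> 'a \<Rightarrow> complex"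
  assumes "compact (UNIV :: 'a set)"
    and "complex_manifold Q"
    and "kaehler_form Q"
    and "liouville_volume Q"
    and "quantum_line_bundle Q"
    and "very_ample Q"
    and "berezin_toeplitz_star_product Q C"
  shows "\<forall>g. smooth_fun Q g \<longrightarrow>
      star C (const_series (\<lambda>_. 1)) (const_series g) = const_series g \<and>
      star C (const_series g) (const_series (\<lambda>_. 1)) = const_series g \<and>
      (\<forall>k\<ge>1. C k (\<lambda>_. 1) g = (\<lambda>_. 0) \<and> C k g (\<lambda>_. 1) = (\<lambda>_. 0))"
proof (intro allI impI)
  fix g :: "'a \<Rightarrow> complex" assume g: "smooth_fun Q g"
  note bt = assms(7)[unfolded berezin_toeplitz_star_product_def]
  interpret berezin_toeplitz Q C
    using assms(1-5) bt by unfold_locales blast+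
  have "twisted k f h = C k f h" if "smooth_fun Q f" "smooth_fun Q h" for k f h
    using bt[THEN conjunct2, THEN conjunct2, rule_format, OF twisted_star_product twisted_asymptotics that] .
  then have C: "C k (\<lambda>_. 1) g = const_series g k" "C k g (\<lambda>_. 1) = const_series g k" for k
    using twisted_unit[OF g] g smooth_fun_on_const by metis+
  have "star C (const_series (\<lambda>_. 1)) (const_series g) = const_series g"
    using star_const_const[OF smooth_fun_on_const g] by (intro ext) (simp add: C)
  moreover have "star C (const_series g) (const_series (\<lambda>_. 1)) = const_series g"
    using star_const_const[OF g smooth_fun_on_const] by (intro ext) (simp add: C)
  ultimately show "star C (const_series (\<lambda>_. 1)) (const_series g) = const_series g \<and>
      star C (const_series g) (const_series (\<lambda>_. 1)) = const_series g \<and>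
      (\<forall>k\<ge>1. C k (\<lambda>_. 1) g = (\<lambda>_. 0) \<and> C k g (\<lambda>_. 1) = (\<lambda>_. 0))"
    by (simp add: C const_series_simps)
qed

end
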